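(* Let $f\in C^2(\tilde\Omega_{\rm c})$ (in the sense specified in the context), and define $R_{\rm ext}\in(\mathcal{U}^\varepsilon)^*$ by $R_{\rm ext}[v]:=\langle f,v\rangle_\varepsilon-\langle f,I_hv\rangle_h$. Then $$\|R_{\rm ext}\|_{\mathcal{U}^{-1,2}}\le\eta^f+\eta^q,$$ where, for $*\in\{f,q\}$, $(\eta^* )^2:=\sum_{k\in\{1,\dots,K\},\,T_k^h\subset\tilde\Omega_{\rm c}}(\eta_k^* )^2$ with $$(\eta_k^f)^2:=\frac{h_k^2}{\pi^2}\|f\|_{L^2(T_k^h)}^2,\qquad(\eta_k^q)^2:=(\varepsilon^4+h_k^4)\|f'\|_{L^2(T_k^h)}^2+\frac{\varepsilon^4+h_k^4}{4\pi^2}\|f''\|_{L^2(T_k^h)}^2.$$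
   Context: Fix $N\in\mathbb{N}$, $\varepsilon=1/(2N)$. A lattice function $v\in\mathbb{R}^{\mathbb{Z}}$ is identified with its continuous piecewise affine interpolant with $v(\varepsilon\ell)=v_\ell$; for continuous $g$, $g_\ell:=g(\varepsilon\ell)$. $\mathcal{U}^\varepsilon:=\{u\in\mathbb{R}^{\mathbb{Z}}:u_{\ell+2N}=u_\ell,\ u_0=0\}$, with norm $\|v\|_{\mathcal{U}^{1,2}}:=\|v'\|_{L^2(-1/2,1/2)}$ and dual norm $\|T\|_{\mathcal{U}^{-1,2}}:=\sup\{T[v]:v\in\mathcal{U}^\varepsilon,\ \|v\|_{\mathcal{U}^{1,2}}=1\}$. Mesh. $\Omega=[-1/2,1/2]$; $\Omega_{\rm a}=(L_{\rm a},R_{\rm a})$ with $-1/2<L_{\rm a}<R_{\rm a}<1/2$; $\Omega_{\rm c}=\Omega\setminus\Omega_{\rm a}$; $\Omega_{\rm c}^\#=\Omega_{\rm c}+\mathbb{Z}$. $\mathcal{T}^h$ is a partition of $\mathbb{R}$ into closed intervals $T_k^h=[x_{k-1}^h,x_k^h]$ ($k\in\mathbb{Z}$, $x^h_{k-1}<x^h_k$), of length $h_k$, such that: (T1) for some $K\in\mathbb{N}$, $x^h_{k+K}=x_k^h+1$ for all $k$; (T2) $\Omega_{\rm a}\cap\varepsilon\mathbb{Z}=\Omega_{\rm a}\cap\{x_k^h\}_{k\in\mathbb{Z}}$; (T3) $L_{\rm a},R_{\rm a}\in\{x_k^h\}$; (T4) $h_k\ge2\varepsilon$ whenever $T_k^h\subset\Omega_{\rm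 c}^\#$. Moreover $0$ is a mesh node (so that nodal interpolation maps $\mathcal{U}^\varepsilon$ into functions vanishing at $0$). Nodes are numbered so that $x_1^h,\dots,x_K^h$ are exactly the nodes in $(-1/2,1/2]$. $\mathcal{P}_1(\mathcal{T}^h)$ is the space of continuous functions affine on each $T_k^h$, and $I_h:C^0(\mathbb{R})\to\mathcal{P}_1(\mathcal{T}^h)$ is nodal interpolation at the $x_k^h$. Forces. $f\in C^0(\mathbb{R})$ is 1-periodic; $\langle f,v\rangle_\varepsilon:=\varepsilon\sum_{\ell=-N+1}^Nf_\ell v_\ell$ and $\langle f,u\rangle_h:=\int_\Omega I_h(fu)\,dx$. Extended continuum region. $T_\ell^\varepsilon=((\ell-1)\varepsilon,\ell\varepsilon)$, and $\tilde\Omega_{\rm c}$ is the union of the closures of all $T_\ell^\varepsilon$, $\ell\in\mathbb{Z}$, with $|T_\ell^\varepsilon\cap\Omega_{\rm c}^\#|>0$ (a closed 1-periodic set). "$f\in C^2(\tilde\Omega_{\rm c})$" means: $f$ is $C^2$ on $\tilde\Omega_{\rm c}\cap[-1/2,1/2]$ (one-sided derivatives at boundary points) and, in case $1/2$ is not a mesh node, also $C^2$ in a neighbourhood of $1/2$. *)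

theory Defs
  imports "HOL-Analysis.Analysis"
begin

text \<open>Meshes are node sequences \<open>x :: int \<Rightarrow> real\<close> with elements \<open>T\<^sub>k = [x\<^bsub>k-1\<^esub>, x\<^sub>k]\<close>.\<close>

definition elem :: "(int \<Rightarrow> real) \<Rightarrow> int \<Rightarrow> real set" where
  "elem x k = {x (k - 1)..x k}"

definition len :: "(int \<Rightarrow> real) \<Rightarrow> int \<Rightarrow> real" where
  "len x k = x k - x (k - 1)"

definition P1 :: "(int \<Rightarrow> real) \<Rightarrow> (real \<Rightarrow> real) set" where
  "P1 x = {w. continuous_on UNIV w \<and> (\<forall>k. \<exists>a b. \<forall>t\<in>elem x k. w t = a + b * t)}"

definition pw_affine :: "(int \<Rightarrow> real) \<Rightarrow> (int \<Rightarrow> real) \<Rightarrow> real \<Rightarrow> real" where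
  "pw_affine x c = (THE w. w \<in> P1 x \<and> (\<forall>k. w (x k) = c k))"

text \<open>The description in \<open>pw_affine\<close> is proper for every mesh that partitions the real line.\<close>

lemma pw_affine_ex1:
  assumes mono: "strict_mono x" and cover: "(\<Union>k. elem x k) = UNIV"
  shows "\<exists>!w. w \<in> P1 x \<and> (\<forall>k. w (x k) = c k)"
proof -
  have lt: "x (k - 1) < x k" for k
    using mono by (simp add: strict_mono_def)
  define g where "g k t = c (k - 1) + (t - x (k - 1)) / (x k - x (k - 1)) * (c k - c (k - 1))" for k t
  have gl: "g k (x (k - 1)) = c (k - 1)" for k by (simp add: g_def)
  have gr: "g k (x k) = c k" for k using lt[of k] by (simp add: g_def)
  have uniq: "w t = g k t"
    if "w \<in> P1 x" "\<forall>k. w (x k) = c k" "t \<in> elem x k" for w k t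
  proof -
    obtain a b where ab: "\<forall>t\<in>elem x k. w t = a + b * t"
      using \<open>w \<in> P1 x\<close> unfolding P1_def by blast
    have 1: "c (k - 1) = a + b * x (k - 1)" "c k = a + b * x k"
      using ab[rule_format, of "x (k - 1)"] ab[rule_format, of "x k"] lt[of k] that(2)
      by (simp_all add: elem_def)
    have d: "c k - c (k - 1) = b * (x k - x (k - 1))"
      by (simp add: 1 algebra_simps)
    have "g k t = a + b * x (k - 1) + (t - x (k - 1)) * b"
      using lt[of k] unfolding g_def d by (simp add: 1)
    then show ?thesis
      using ab that(3) by (simp add: algebra_simps)
  qed
  define w where "w t = g (SOME k. t \<in> elem x k) t" for t
  have agree: "g j t = g k t" if "t \<in> elem x j" "t \<in> elem x k" for j k t
  proof -
    have *: "g j t = g k t" if "t \<in> elem x j" "t \<in> elem x k" "j < k" for j k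
    proof -
      have "x j \<le> x (k - 1)" using mono that(3) by (simp add: strict_mono_less_eq)
      then have e: "t = x j" "t = x (k - 1)" using that by (auto simp: elem_def)
      then have "j = k - 1" using mono by (metis strict_mono_eq)
      then show ?thesis using e gl[of k] gr[of j] by simp
    qed
    show ?thesis using * that by (metis linorder_neqE)
  qed
  have w: "w t = g k t" if "t \<in> elem x k" for t k
    unfolding w_def by (rule agree) (auto intro: someI that)
  have node: "w (x k) = c k" for k
    using w[of "x k" k] gr[of k] lt[of k] by (simp add: elem_def)
  have cont1: "continuous_on (elem x k) w" for k
  proof -
    have "continuous_on (elem x k) (g k)"
      unfolding g_def using lt[of k] by (intro continuous_intros) auto
    then show ?thesis using w by (simp cong: continuous_on_cong)
  qed
  have "isCont w t" for t
  proof -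
    obtain k where k: "t \<in> elem x k" using cover by blast
    have "continuous_on (elem x (k - 1) \<union> elem x k \<union> elem x (k + 1)) w"
      by (intro continuous_on_closed_Un cont1 closed_Un) (auto simp: elem_def)
    moreover have "{x (k - 2)<..<x (k + 1)} \<subseteq> elem x (k - 1) \<union> elem x k \<union> elem x (k + 1)"
      by (auto simp: elem_def)
    ultimately have "continuous_on {x (k - 2)<..<x (k + 1)} w"
      by (rule continuous_on_subset)
    moreover have "t \<in> {x (k - 2)<..<x (k + 1)}"
      using k lt[of "k - 1"] lt[of "k + 1"] by (auto simp: elem_def)
    ultimately show ?thesis
      by (simp add: continuous_on_eq_continuous_at)
  qed
  then have cont: "continuous_on UNIV w"
    by (simp add: continuous_at_imp_continuous_on)
  have aff: "\<exists>a b. \<forall>t\<in>elem x k. w t = a + b * t" for k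
  proof -
    define b where "b = (c k - c (k - 1)) / (x k - x (k - 1))"
    have "g k t = (c (k - 1) - b * x (k - 1)) + b * t" for t
      by (simp add: g_def b_def diff_divide_distrib algebra_simps)
    then show ?thesis using w by metis
  qed
  have "w \<in> P1 x \<and> (\<forall>k. w (x k) = c k)"
    using cont aff node by (simp add: P1_def)
  moreover have "v = w" if "v \<in> P1 x \<and> (\<forall>k. v (x k) = c k)" for v
  proof
    fix t
    obtain k where k: "t \<in> elem x k" using cover by blast
    then show "v t = w t" using uniq[of v t k] w[OF k] that by simp
  qed
  ultimately show ?thesis by blast
qed

definition nodal_interp :: "(int \<Rightarrow> real) \<Rightarrow> (real \<Rightarrow> real) \<Rightarrow> real \<Rightarrow> real" where
  "nodal_interp x g = pw_affine x (\<lambda>k. g (x k))"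

definition L2_norm_on :: "real set \<Rightarrow> (real \<Rightarrow> real) \<Rightarrow> real" where
  "L2_norm_on S g = sqrt (integral S (\<lambda>t. (g t)\<^sup>2))"

definition eps :: "nat \<Rightarrow> real" where
  "eps N = 1 / (2 * real N)"

definition lattice :: "nat \<Rightarrow> int \<Rightarrow> real" where
  "lattice N l = eps N * of_int l"

definition lat_fun :: "nat \<Rightarrow> (int \<Rightarrow> real) \<Rightarrow> real \<Rightarrow> real" where
  "lat_fun N v = pw_affine (lattice N) v"

definition U :: "nat \<Rightarrow> (int \<Rightarrow> real) set" where
  "U N = {u. (\<forall>l. u (l + 2 * int N) = u l) \<and> u 0 = 0}"

text \<open>The interpolant is differentiable off the lattice, a null set, so the value of
  \<open>deriv\<close> at lattice points is irrelevant.\<close>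

definition norm_U :: "nat \<Rightarrow> (int \<Rightarrow> real) \<Rightarrow> real" where
  "norm_U N v = L2_norm_on {-1/2<..<1/2} (deriv (lat_fun N v))"

text \<open>For \<open>N \<ge> 1\<close> the unit sphere is nonempty, and since \<open>U N\<close> is finite-dimensional the
  supremum of a linear functional over it is finite.\<close>

definition dual_norm_U :: "nat \<Rightarrow> ((int \<Rightarrow> real) \<Rightarrow> real) \<Rightarrow> real" where
  "dual_norm_U N T = Sup {T v |v. v \<in> U N \<and> norm_U N v = 1}"

definition Omega_a :: "real \<Rightarrow> real \<Rightarrow> real set" where
  "Omega_a La Ra = {La<..<Ra}"

definition Omega_c :: "real \<Rightarrow> real \<Rightarrow> real set" where
  "Omega_c La Ra = {-1/2..1/2} - Omega_a La Ra"

definition Omega_c_per :: "real \<Rightarrow> real \<Rightarrow> real set" where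
  "Omega_c_per La Ra = {t + of_int m |t m. t \<in> Omega_c La Ra}"

definition lat_int :: "nat \<Rightarrow> int \<Rightarrow> real set" where
  "lat_int N l = {lattice N (l - 1)<..<lattice N l}"

definition Omega_c_ext :: "nat \<Rightarrow> real \<Rightarrow> real \<Rightarrow> real set" where
  "Omega_c_ext N La Ra =
     (\<Union>l \<in> {l. measure lborel (lat_int N l \<inter> Omega_c_per La Ra) > 0}. closure (lat_int N l))"

definition qc_mesh :: "nat \<Rightarrow> real \<Rightarrow> real \<Rightarrow> nat \<Rightarrow> (int \<Rightarrow> real) \<Rightarrow> bool" where
  "qc_mesh N La Ra K x \<longleftrightarrow>
     strict_mono x \<and> (\<Union>k. elem x k) = UNIV \<and>
     (\<forall>k. x (k + int K) = x k + 1) \<and>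
     Omega_a La Ra \<inter> range (lattice N) = Omega_a La Ra \<inter> range x \<and>
     La \<in> range x \<and> Ra \<in> range x \<and>
     (\<forall>k. elem x k \<subseteq> Omega_c_per La Ra \<longrightarrow> len x k \<ge> 2 * eps N) \<and>
     0 \<in> range x \<and>
     x ` {1..int K} = range x \<inter> {-1/2<..1/2}"

text \<open>Derivatives are taken within the set, hence one-sided at boundary points of intervals.\<close>

definition C2_on :: "(real \<Rightarrow> real) \<Rightarrow> real set \<Rightarrow> bool" where
  "C2_on f S \<longleftrightarrow> (\<exists>f1 f2.
     (\<forall>t\<in>S. (f has_real_derivative f1 t) (at t within S)) \<and>
     (\<forall>t\<in>S. (f1 has_real_derivative f2 t) (at t within S)) \<and>
     continuous_on S f2)"

definition C2_ext :: "nat \<Rightarrow> real \<Rightarrow> real \<Rightarrow> (int \<Rightarrow> real) \<Rightarrow> (real \<Rightarrow> real) \<Rightarrow> bool" where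
  "C2_ext N La Ra x f \<longleftrightarrow>
     C2_on f (Omega_c_ext N La Ra \<inter> {-1/2..1/2}) \<and>
     (1/2 \<notin> range x \<longrightarrow> (\<exists>d>0. C2_on f {1/2 - d<..<1/2 + d}))"

definition inner_eps :: "nat \<Rightarrow> (real \<Rightarrow> real) \<Rightarrow> (int \<Rightarrow> real) \<Rightarrow> real" where
  "inner_eps N f v = eps N * (\<Sum>l\<in>{- int N + 1..int N}. f (lattice N l) * v l)"

definition inner_h :: "(int \<Rightarrow> real) \<Rightarrow> (real \<Rightarrow> real) \<Rightarrow> (real \<Rightarrow> real) \<Rightarrow> real" where
  "inner_h x f u = integral {-1/2..1/2} (nodal_interp x (\<lambda>t. f t * u t))"

definition R_ext :: "nat \<Rightarrow> (int \<Rightarrow> real) \<Rightarrow> (real \<Rightarrow> real) \<Rightarrow> (int \<Rightarrow> real) \<Rightarrow> real" where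
  "R_ext N x f v = inner_eps N f v - inner_h x f (nodal_interp x (lat_fun N v))"

definition elems_c_ext :: "nat \<Rightarrow> real \<Rightarrow> real \<Rightarrow> nat \<Rightarrow> (int \<Rightarrow> real) \<Rightarrow> int set" where
  "elems_c_ext N La Ra K x = {k \<in> {1..int K}. elem x k \<subseteq> Omega_c_ext N La Ra}"

definition eta_f_sq :: "(int \<Rightarrow> real) \<Rightarrow> (real \<Rightarrow> real) \<Rightarrow> int \<Rightarrow> real" where
  "eta_f_sq x f k = (len x k)\<^sup>2 / pi\<^sup>2 * (L2_norm_on (elem x k) f)\<^sup>2"

text \<open>On an element contained in the extended continuum region, a \<open>C\<^sup>2\<close> function in the above sense
  is twice differentiable in the interior, so \<open>deriv f\<close> and \<open>deriv (deriv f)\<close> agree there almost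
  everywhere with the (one-sided) derivatives.\<close>

definition eta_q_sq :: "nat \<Rightarrow> (int \<Rightarrow> real) \<Rightarrow> (real \<Rightarrow> real) \<Rightarrow> int \<Rightarrow> real" where
  "eta_q_sq N x f k =
     (eps N ^ 4 + len x k ^ 4) * (L2_norm_on (elem x k) (deriv f))\<^sup>2 +
     (eps N ^ 4 + len x k ^ 4) / (4 * pi\<^sup>2) * (L2_norm_on (elem x k) (deriv (deriv f)))\<^sup>2"

definition eta_f :: "nat \<Rightarrow> real \<Rightarrow> real \<Rightarrow> nat \<Rightarrow> (int \<Rightarrow> real) \<Rightarrow> (real \<Rightarrow> real) \<Rightarrow> real" where
  "eta_f N La Ra K x f = sqrt (\<Sum>k\<in>elems_c_ext N La Ra K x. eta_f_sq x f k)"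

definition eta_q :: "nat \<Rightarrow> real \<Rightarrow> real \<Rightarrow> nat \<Rightarrow> (int \<Rightarrow> real) \<Rightarrow> (real \<Rightarrow> real) \<Rightarrow> real" where
  "eta_q N La Ra K x f = sqrt (\<Sum>k\<in>elems_c_ext N La Ra K x. eta_q_sq N x f k)"

end

theory Submission
  imports Defs "HOL-Real_Asymp.Real_Asymp"
begin

text \<open>
  Both \<open>\<langle>f, v\<rangle>\<^sub>\<epsilon>\<close> and \<open>\<langle>f, I\<^sub>h v\<rangle>\<^sub>h\<close> are trapezoidal rules over one period, so with \<open>V\<close> the lattice
  interpolant and \<open>W = I\<^sub>h V\<close> the residual is
  \<open>\<integral> (I\<^sub>\<epsilon> (f V) - f V) + \<integral> f (V - W) + \<integral> (f W - I\<^sub>h (f W))\<close>. Since \<open>0\<close> is both a lattice point and a mesh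
  node, the period \<open>[0, 1]\<close> is a union of elements of either mesh and \<open>V\<close>, \<open>W\<close> vanish at its ends.
  An element not contained in the extended continuum region is a single lattice interval, so off that
  region the three integrands cancel. On the region the middle term is bounded elementwise by the
  sharp Poincare inequality with constant \<open>h\<^sub>k / \<pi>\<close>, which gives the first estimator. The two quadrature
  errors are, up to sign, \<open>\<integral> (t - a) (b - t) / 2 * (f'' w + 2 f' w')\<close> on an interval \<open>[a, b]\<close>; the weight is at most
  \<open>(b - a)\<^sup>2 / 8\<close> and \<open>\<parallel>w\<parallel> \<le> \<parallel>w'\<parallel> / \<pi>\<close> on \<open>[0, 1]\<close>, which gives the second one.
\<close>

subsection \<open>Integral inequalities\<close>

lemma L2_norm_on_nonneg: "0 \<le> L2_norm_on S g"
proof -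
  \<comment> \<open>The integral of a non-integrable function is 0 by convention, so the square root
    is always taken of a nonnegative number.\<close>
  have "0 \<le> integral S (\<lambda>t. (g t)\<^sup>2)"
    by (cases "(\<lambda>t. (g t)\<^sup>2) integrable_on S") (simp_all add: integral_nonneg not_integrable_integral)
  then show ?thesis by (simp add: L2_norm_on_def)
qed

lemma L2_norm_on_sq: "(L2_norm_on S g)\<^sup>2 = integral S (\<lambda>t. (g t)\<^sup>2)"
proof -
  have "0 \<le> integral S (\<lambda>t. (g t)\<^sup>2)"
    by (cases "(\<lambda>t. (g t)\<^sup>2) integrable_on S") (simp_all add: integral_nonneg not_integrable_integral)
  then show ?thesis by (simp add: L2_norm_on_def)
qed

text \<open>Cauchy-Schwarz by the discriminant argument: the integral of
  \<open>(r * f - g)^2\<close> is a nonnegative quadratic polynomial in \<open>r\<close>.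
  Integrability of the product is assumed separately from that of the two squares.\<close>

lemma abs_integral_mult_le:
  fixes f g :: "real \<Rightarrow> real"
  assumes "(\<lambda>t. f t * g t) integrable_on S" "(\<lambda>t. (f t)\<^sup>2) integrable_on S"
    "(\<lambda>t. (g t)\<^sup>2) integrable_on S"
  shows "\<bar>integral S (\<lambda>t. f t * g t)\<bar> \<le> L2_norm_on S f * L2_norm_on S g"
proof -
  define A B C where "A = integral S (\<lambda>t. (f t)\<^sup>2)" and "B = integral S (\<lambda>t. (g t)\<^sup>2)"
    and "C = integral S (\<lambda>t. f t * g t)"
  have I: "((\<lambda>t. (f t)\<^sup>2) has_integral A) S" "((\<lambda>t. (g t)\<^sup>2) has_integral B) S"
    "((\<lambda>t. f t * g t) has_integral C) S"
    unfolding A_def B_def C_def using assms by (auto intro: integrable_integral)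
  have *: "0 \<le> r\<^sup>2 * A - (2 * r) * C + B" for r
  proof -
    have "((\<lambda>t. r\<^sup>2 * (f t)\<^sup>2 - (2 * r) * (f t * g t) + (g t)\<^sup>2) has_integral
        (r\<^sup>2 * A - (2 * r) * C + B)) S"
      by (intro has_integral_add has_integral_diff has_integral_mult_right I)
    then have "((\<lambda>t. (r * f t - g t)\<^sup>2) has_integral (r\<^sup>2 * A - (2 * r) * C + B)) S"
      by (rule has_integral_eq[rotated]) (simp add: power2_eq_square algebra_simps)
    then show ?thesis by (rule has_integral_nonneg) simp
  qed
  have A0: "0 \<le> A" using I(1) by (rule has_integral_nonneg) simp
  have "C\<^sup>2 \<le> A * B"
  proof (cases "A = 0")
    case True
    have "C = 0"
    proof (rule ccontr)
      assume "C \<noteq> 0"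
      \<comment> \<open>If \<open>A = 0\<close>, the polynomial is affine in \<open>r\<close>, and
        at this \<open>r\<close> it takes the value -1.\<close>
      then show False using *[of "(B + 1) / (2 * C)"] True by simp
    qed
    then show ?thesis using True by simp
  next
    case False
    then have "A > 0" using A0 by simp
    \<comment> \<open>The minimiser of the quadratic.\<close>
    then show ?thesis using *[of "C / A"]
      by (simp add: field_simps power2_eq_square)
  qed
  then have "sqrt (C\<^sup>2) \<le> sqrt (A * B)" by (rule real_sqrt_le_mono)
  then show ?thesis
    by (simp add: real_sqrt_mult L2_norm_on_def A_def B_def C_def)
qed

lemma L2_norm_on_cong:
  assumes "finite N" "\<And>t. t \<in> S - N \<Longrightarrow> f t = g t"
  shows "L2_norm_on S f = L2_norm_on S g"
proof -
  have "integral S (\<lambda>t. (f t)\<^sup>2) = integral S (\<lambda>t. (g t)\<^sup>2)"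
    using assms by (intro integral_spike[of N]) (auto simp: negligible_finite)
  then show ?thesis by (simp add: L2_norm_on_def)
qed

text \<open>The one-dimensional Poincare inequality for zero end values, with its sharp constant.
  The finite exceptional set and the bounded derivative fit piecewise affine functions; the bound
  also provides the Lipschitz estimate \<open>lip\<close> that tames the weight, which is singular
  at both ends.\<close>

lemma wirtinger:
  fixes w w' :: "real \<Rightarrow> real"
  assumes "a < b" and "finite S" and cont: "continuous_on {a..b} w"
    and zero: "w a = 0" "w b = 0"
    and der: "\<And>t. t \<in> {a<..<b} - S \<Longrightarrow> (w has_real_derivative w' t) (at t)"
    and bd: "\<And>t. t \<in> {a<..<b} - S \<Longrightarrow> \<bar>w' t\<bar> \<le> M"
    and int: "(\<lambda>t. (w' t)\<^sup>2) integrable_on {a..b}"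
  shows "L2_norm_on {a..b} w \<le> (b - a) / pi * L2_norm_on {a..b} w'"
proof -
  define q where "q = pi / (b - a)"
  have q: "q > 0" using \<open>a < b\<close> by (simp add: q_def)
  have qb: "q * (b - a) = pi" using \<open>a < b\<close> by (simp add: q_def)
  have lip: "\<bar>w t - w s\<bar> \<le> \<bar>M\<bar> * (t - s)" if "a \<le> s" "s \<le> t" "t \<le> b" for s t
  proof -
    \<comment> \<open>With the value 0 at the exceptional points the derivative is bounded by
      \<open>|M|\<close> everywhere.\<close>
    define w0 where "w0 u = (if u \<in> {a<..<b} - S then w' u else 0)" for u
    have "(w0 has_integral (w t - w s)) {s..t}"
    proof (rule fundamental_theorem_of_calculus_interior_strong[OF \<open>finite S\<close> \<open>s \<le> t\<close>])
      show "(w has_vector_derivative w0 u) (at u)" if "u \<in> {s<..<t} - S" for u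
        using der[of u] that \<open>a \<le> s\<close> \<open>t \<le> b\<close>
        by (auto simp: w0_def has_real_derivative_iff_has_vector_derivative)
      show "continuous_on {s..t} w"
        using cont by (rule continuous_on_subset) (use that in auto)
    qed
    then have "norm (w t - w s) \<le> \<bar>M\<bar> * measure lborel (cbox s t)"
      unfolding box_real[symmetric]
      by (rule has_integral_bound[rotated]) (use bd in \<open>fastforce simp: w0_def\<close>)+
    then show ?thesis using \<open>s \<le> t\<close> by simp
  qed
  \<comment> \<open>\<open>c = q cot (q (t - a))\<close> solves the Riccati equation \<open>c' = - q\<^sup>2 - c\<^sup>2\<close>, so that
    \<open>w'\<^sup>2 - q\<^sup>2 w\<^sup>2 = (c w\<^sup>2)' + (w' - c w)\<^sup>2\<close>; the boundary terms of \<open>c w\<^sup>2\<close> vanish as \<open>w\<close> is Lipschitz.\<close>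
  define F where "F t = (if t \<in> {a<..<b} then q * cot (q * (t - a)) * (w t)\<^sup>2 else 0)" for t
  have sinpos: "sin (q * (t - a)) > 0" if "t \<in> {a<..<b}" for t
  proof (rule sin_gt_zero)
    show "0 < q * (t - a)" using q that by simp
    have "q * (t - a) < q * (b - a)" using q that by simp
    then show "q * (t - a) < pi" using qb by simp
  qed
  have cotder: "((\<lambda>t. q * cot (q * (t - a))) has_real_derivative
      - q\<^sup>2 - (q * cot (q * (t - a)))\<^sup>2) (at t)" if "t \<in> {a<..<b}" for t
  proof -
    have s: "sin (q * (t - a)) \<noteq> 0" using sinpos[OF that] by simp
    have "((\<lambda>t. q * cot (q * (t - a))) has_real_derivative
        q * (- inverse ((sin (q * (t - a)))\<^sup>2) * (q * 1))) (at t)"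
      by (intro DERIV_cmult DERIV_chain2[where f = cot and g = "\<lambda>t. q * (t - a)"] DERIV_cot s) (auto intro!: derivative_eq_intros)
    moreover have "q * (- inverse ((sin (q * (t - a)))\<^sup>2) * (q * 1)) = - q\<^sup>2 - (q * cot (q * (t - a)))\<^sup>2"
    proof -
      have "inverse ((sin (q * (t - a)))\<^sup>2) = 1 + (cot (q * (t - a)))\<^sup>2"
        using s by (simp add: cot_def field_simps)
      then show ?thesis by (simp only:) (simp add: algebra_simps power2_eq_square)
    qed
    ultimately show ?thesis by simp
  qed
  \<comment> \<open>Near 0, \<open>q * cot (q * u)\<close> behaves like \<open>1 / u\<close>, so the
    product is of order \<open>u\<close>.\<close>
  have lim0: "((\<lambda>u. q * cot (q * u) * (\<bar>M\<bar> * u)\<^sup>2) \<longlongrightarrow> 0) (at_right 0)"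
  proof -
    have "((\<lambda>u. q * (cos (q * u) / sin (q * u)) * u\<^sup>2) \<longlongrightarrow> 0) (at_right 0)"
      using q by real_asymp
    then have "((\<lambda>u. q * (cos (q * u) / sin (q * u)) * u\<^sup>2 * M\<^sup>2) \<longlongrightarrow> 0) (at_right 0)"
      by (rule tendsto_mult_left_zero)
    then show ?thesis by (simp add: cot_def power_mult_distrib mult_ac)
  qed
  have Fa: "(F \<longlongrightarrow> 0) (at_right a)"
  proof -
    have "((\<lambda>t. q * cot (q * (t - a)) * (\<bar>M\<bar> * (t - a))\<^sup>2) \<longlongrightarrow> 0) (at_right a)"
      using lim0 by (subst at_right_to_0) (simp add: filterlim_filtermap)
    then show ?thesis
    proof (rule Lim_null_comparison[OF _ tendsto_rabs_zero, rotated])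
      show "\<forall>\<^sub>F t in at_right a. norm (F t) \<le> \<bar>q * cot (q * (t - a)) * (\<bar>M\<bar> * (t - a))\<^sup>2\<bar>"
      proof (rule eventually_mono)
        show "\<forall>\<^sub>F t in at_right a. a < t \<and> t < b"
          using \<open>a < b\<close> by (auto simp: eventually_at_right intro!: exI[of _ b])
      next
        fix t assume t: "a < t \<and> t < b"
        have "\<bar>w t\<bar> \<le> \<bar>M\<bar> * (t - a)" using lip[of a t] zero t by simp
        then have "(w t)\<^sup>2 \<le> (\<bar>M\<bar> * (t - a))\<^sup>2" by (metis abs_ge_zero power2_abs power_mono)
        then show "norm (F t) \<le> \<bar>q * cot (q * (t - a)) * (\<bar>M\<bar> * (t - a))\<^sup>2\<bar>"
          using t by (simp add: F_def abs_mult mult_left_mono)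
      qed
    qed
  qed
  have Fb: "(F \<longlongrightarrow> 0) (at_left b)"
  proof -
    \<comment> \<open>The right end is reduced to \<open>lim0\<close> by the reflection
      \<open>u = b - t\<close>, under which the cotangent changes sign.\<close>
    have "((\<lambda>u. q * cot (q * (b - u - a)) * (\<bar>M\<bar> * u)\<^sup>2) \<longlongrightarrow> 0) (at_right 0)"
    proof -
      have "q * (b - u - a) = pi - q * u" for u using qb by (simp add: algebra_simps)
      moreover have "cot (pi - y) = - cot y" for y :: real by (simp add: cot_def)
      ultimately show ?thesis using tendsto_minus[OF lim0] by simp
    qed
    then have "((\<lambda>t. q * cot (q * (t - a)) * (\<bar>M\<bar> * (b - t))\<^sup>2) \<longlongrightarrow> 0) (at_left b)"
      by (subst at_left_minus, subst at_right_to_0)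
        (simp add: filterlim_filtermap algebra_simps)
    then show ?thesis
    proof (rule Lim_null_comparison[OF _ tendsto_rabs_zero, rotated])
      show "\<forall>\<^sub>F t in at_left b. norm (F t) \<le> \<bar>q * cot (q * (t - a)) * (\<bar>M\<bar> * (b - t))\<^sup>2\<bar>"
      proof (rule eventually_mono)
        show "\<forall>\<^sub>F t in at_left b. a < t \<and> t < b"
          using \<open>a < b\<close> by (auto simp: eventually_at_left intro!: exI[of _ a])
      next
        fix t assume t: "a < t \<and> t < b"
        have "\<bar>w t\<bar> \<le> \<bar>M\<bar> * (b - t)" using lip[of t b] zero t by simp
        then have "(w t)\<^sup>2 \<le> (\<bar>M\<bar> * (b - t))\<^sup>2" by (metis abs_ge_zero power2_abs power_mono)
        then show "norm (F t) \<le> \<bar>q * cot (q * (t - a)) * (\<bar>M\<bar> * (b - t))\<^sup>2\<bar>"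
          using t by (simp add: F_def abs_mult mult_left_mono)
      qed
    qed
  qed
  define F' where "F' t = (w' t)\<^sup>2 - q\<^sup>2 * (w t)\<^sup>2 - (w' t - q * cot (q * (t - a)) * w t)\<^sup>2" for t
  have Fder: "(F has_real_derivative F' t) (at t)" if "t \<in> {a<..<b} - S" for t
  proof -
    have t: "t \<in> {a<..<b}" using that by simp
    have "((\<lambda>t. q * cot (q * (t - a)) * (w t)\<^sup>2) has_real_derivative
       (- q\<^sup>2 - (q * cot (q * (t - a)))\<^sup>2) * (w t)\<^sup>2 + 2 * w t * w' t * (q * cot (q * (t - a)))) (at t)"
      by (rule DERIV_cong[OF DERIV_mult[OF cotder[OF t] DERIV_power[OF der[OF that], of 2]]]) simp
    moreover have "(- q\<^sup>2 - (q * cot (q * (t - a)))\<^sup>2) * (w t)\<^sup>2 + 2 * w t * w' t * (q * cot (q * (t - a))) = F' t"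
      by (simp add: F'_def power2_eq_square algebra_simps)
    ultimately have "((\<lambda>t. q * cot (q * (t - a)) * (w t)\<^sup>2) has_real_derivative F' t) (at t)" by simp
    then show ?thesis
      by (rule has_field_derivative_transform_within_open[of _ _ _ "{a<..<b}"]) (use t in \<open>auto simp: F_def\<close>)
  qed
  have Fcont: "continuous_on {a..b} F"
  proof (rule continuous_on_IccI)
    show "(F \<longlongrightarrow> F a) (at_right a)" "(F \<longlongrightarrow> F b) (at_left b)" using Fa Fb by (simp_all add: F_def)
    show "a < b" by fact
    show "F \<midarrow>t\<rightarrow> F t" if "a < t" "t < b" for t
    proof -
      have t: "t \<in> {a<..<b}" using that by simp
      have "isCont w t" using cont t by (metis atLeastAtMost_iff continuous_on_interior greaterThanLessThan_iff interior_atLeastAtMost_real)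
      then have "isCont (\<lambda>t. q * cot (q * (t - a)) * (w t)\<^sup>2) t"
        by (intro isCont_mult[OF DERIV_isCont[OF cotder[OF t]]] isCont_power)
      then have "(\<lambda>t. q * cot (q * (t - a)) * (w t)\<^sup>2) \<midarrow>t\<rightarrow> F t"
        using t by (simp add: isCont_def F_def)
      then show ?thesis
        by (rule Lim_transform_within_open[of _ _ _ _ "{a<..<b}"]) (use t in \<open>auto simp: F_def\<close>)
    qed
  qed
  have "(F' has_integral (F b - F a)) {a..b}"
    using \<open>finite S\<close> less_imp_le[OF \<open>a < b\<close>] Fder Fcont
    by (intro fundamental_theorem_of_calculus_interior_strong[of S])
      (auto simp: has_real_derivative_iff_has_vector_derivative[symmetric])
  then have I1: "(F' has_integral 0) {a..b}" by (simp add: F_def)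
  have "(\<lambda>t. (w t)\<^sup>2) integrable_on {a..b}"
    by (intro integrable_continuous_interval continuous_intros cont)
  then have I2: "((\<lambda>t. (w' t)\<^sup>2 - q\<^sup>2 * (w t)\<^sup>2) has_integral
      ((L2_norm_on {a..b} w')\<^sup>2 - q\<^sup>2 * (L2_norm_on {a..b} w)\<^sup>2)) {a..b}"
    unfolding L2_norm_on_sq using int
    by (intro has_integral_diff has_integral_mult_right integrable_integral)
  have "0 \<le> (L2_norm_on {a..b} w')\<^sup>2 - q\<^sup>2 * (L2_norm_on {a..b} w)\<^sup>2"
    using I1 I2 by (rule has_integral_le) (simp add: F'_def)
  then have "(q * L2_norm_on {a..b} w)\<^sup>2 \<le> (L2_norm_on {a..b} w')\<^sup>2"
    by (simp add: power_mult_distrib)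
  then have "q * L2_norm_on {a..b} w \<le> L2_norm_on {a..b} w'"
    by (rule power2_le_imp_le) (rule L2_norm_on_nonneg)
  then show ?thesis using \<open>a < b\<close> by (simp add: q_def field_simps)
qed

section \<open>Twice continuously differentiable functions on intervals: translation, gluing,
  derivatives\<close>

lemma C2_on_subset: "C2_on f S \<Longrightarrow> T \<subseteq> S \<Longrightarrow> C2_on f T"
  unfolding C2_on_def by (meson DERIV_subset continuous_on_subset subsetD)

text \<open>Smoothness of the force is given on one period only; this carries it to the
  translates.\<close>

lemma C2_on_shift:
  assumes "C2_on f S" and per: "\<And>t. f (t + r) = f t"
  shows "C2_on f {t. t - r \<in> S}"
proof -
  obtain f1 f2 where f: "\<And>t. t \<in> S \<Longrightarrow> (f has_real_derivative f1 t) (at t within S)"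
    "\<And>t. t \<in> S \<Longrightarrow> (f1 has_real_derivative f2 t) (at t within S)" "continuous_on S f2"
    using assms(1) unfolding C2_on_def by blast
  let ?T = "{t. t - r \<in> S}"
  have img: "(\<lambda>t. t - r) ` ?T = S"
    by (auto simp: image_iff intro!: exI[of _ "_ + r"])
  have fr: "f = f \<circ> (\<lambda>t. t - r)"
    using per[of "_ - r"] by (auto simp: fun_eq_iff)
  have D: "(g \<circ> (\<lambda>t. t - r) has_real_derivative d * 1) (at t within ?T)"
    if "(g has_real_derivative d) (at (t - r) within S)" for g d t
    by (rule DERIV_image_chain) (use that img in \<open>auto intro!: derivative_eq_intros\<close>)
  have "(f has_real_derivative f1 (t - r)) (at t within ?T)" if "t \<in> ?T" for t
    using D[OF f(1)[of "t - r"]] that fr by simp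
  moreover have "((\<lambda>t. f1 (t - r)) has_real_derivative f2 (t - r)) (at t within ?T)" if "t \<in> ?T" for t
    using D[OF f(2)[of "t - r"]] that by (simp add: o_def)
  moreover have "continuous_on ?T (\<lambda>t. f2 (t - r))"
    by (rule continuous_on_compose2[OF f(3)]) (auto intro!: continuous_intros)
  ultimately show ?thesis
    unfolding C2_on_def by (intro exI[of _ "\<lambda>t. f1 (t - r)"] exI[of _ "\<lambda>t. f2 (t - r)"]) blast
qed

text \<open>\<open>C2_on\<close> hides its derivatives behind an existential quantifier, so local
  witnesses have to be glued. On a nondegenerate interval the derivative within the interval is
  unique; hence the chosen values \<open>D f\<close> and \<open>D (D f)\<close> agree with every
  local witness.\<close>

lemma C2_on_local:
  fixes a b :: real
  assumes "a < b"
    and loc: "\<And>t. t \<in> {a..b} \<Longrightarrow> \<exists>A. open A \<and> t \<in> A \<and> C2_on f (A \<inter> {a..b})"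
  shows "C2_on f {a..b}"
proof -
  let ?J = "{a..b}"
  define D where "D g t = (SOME d. (g has_real_derivative d) (at t within ?J))" for g t
  have D: "D g t = d" if "(g has_real_derivative d) (at t within ?J)" "t \<in> ?J" for g d t
  proof -
    have "(g has_real_derivative D g t) (at t within ?J)"
      unfolding D_def using that(1) by (rule someI)
    moreover have "at t within ?J \<noteq> bot"
      using that(2) \<open>a < b\<close> by (simp add: trivial_limit_within islimpt_Icc)
    ultimately show ?thesis using that(1)
      by (metis has_real_derivative_iff_has_vector_derivative vector_derivative_unique_within)
  qed
  define f1 f2 where "f1 = D f" and "f2 = D f1"
  have "(f has_real_derivative f1 t) (at t within ?J) \<and>
    (f1 has_real_derivative f2 t) (at t within ?J) \<and> continuous (at t within ?J) f2"
    if t: "t \<in> ?J" for t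
  proof -
    obtain A where A: "open A" "t \<in> A" "C2_on f (A \<inter> ?J)" using loc[OF t] by blast
    have at: "at s within A \<inter> ?J = at s within ?J" if "s \<in> A" for s
      using A(1) that by (intro at_within_nhd[of _ A]) auto
    obtain u1 u2 where "\<And>s. s \<in> A \<inter> ?J \<Longrightarrow> (f has_real_derivative u1 s) (at s within A \<inter> ?J)"
      "\<And>s. s \<in> A \<inter> ?J \<Longrightarrow> (u1 has_real_derivative u2 s) (at s within A \<inter> ?J)"
      and u2c: "continuous_on (A \<inter> ?J) u2"
      using A(3) unfolding C2_on_def by blast
    then have u: "(f has_real_derivative u1 s) (at s within ?J)"
      "(u1 has_real_derivative u2 s) (at s within ?J)" if "s \<in> A \<inter> ?J" for s
      using that at by auto
    have e1: "f1 s = u1 s" if "s \<in> A \<inter> ?J" for s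
      unfolding f1_def using D u(1) that by blast
    have d2: "(f1 has_real_derivative u2 s) (at s within ?J)" if s: "s \<in> A \<inter> ?J" for s
    proof -
      obtain e where "e > 0" "ball s e \<subseteq> A" using A(1) s openE by blast
      then show ?thesis
        by (intro has_field_derivative_transform_within[OF u(2)[OF s] \<open>e > 0\<close>])
          (use s e1 in \<open>auto simp: dist_commute subset_iff\<close>)
    qed
    have e2: "f2 s = u2 s" if "s \<in> A \<inter> ?J" for s
      unfolding f2_def using D d2 that by blast
    have "continuous_on (A \<inter> ?J) f2" by (rule continuous_on_eq[OF u2c]) (simp add: e2)
    then have "continuous (at t within A \<inter> ?J) f2"
      using A(2) t by (auto simp: continuous_on_eq_continuous_within)
    then have "continuous (at t within ?J) f2" by (simp only: at[OF A(2)])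
    then show ?thesis using u(1) d2 e1 e2 A(2) t by auto
  qed
  then show ?thesis
    unfolding C2_on_def continuous_on_eq_continuous_within by (intro exI[of _ f1] exI[of _ f2]) simp
qed

text \<open>Smoothness on both sides of \<open>c\<close> would still allow a kink at
  \<open>c\<close>; the open neighbourhood in the middle forces the one-sided derivatives to match.
  This serves the half-integer points, where two periods meet.\<close>

lemma C2_on_combine:
  fixes a b c d :: real
  assumes "a < c" "c < b" and l: "C2_on f {a..c}" and m: "d > 0" "C2_on f {c - d<..<c + d}"
    and r: "C2_on f {c..b}"
  shows "C2_on f {a..b}"
proof (rule C2_on_local)
  show "a < b" using assms by simp
  show "\<exists>A. open A \<and> t \<in> A \<and> C2_on f (A \<inter> {a..b})" if "t \<in> {a..b}" for t
  proof (cases t c rule: linorder_cases)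
    case less
    then show ?thesis
      by (intro exI[of _ "{..<c}"]) (auto intro!: C2_on_subset[OF l])
  next
    case equal
    then show ?thesis using m(1)
      by (intro exI[of _ "{c - d<..<c + d}"]) (auto intro!: C2_on_subset[OF m(2)])
  next
    case greater
    then show ?thesis
      by (intro exI[of _ "{c<..}"]) (auto intro!: C2_on_subset[OF r])
  qed
qed

text \<open>Connects the one-sided derivatives with \<open>deriv\<close>, in which the estimators
  are written. \<open>f1\<close> and \<open>f2\<close> are continuous up to the end points, where
  nothing is claimed about \<open>deriv\<close>.\<close>

lemma C2_on_Icc_deriv:
  fixes a b :: real
  assumes "a < b" and "C2_on f {a..b}"
  obtains f1 f2 where "continuous_on {a..b} f" "continuous_on {a..b} f1" "continuous_on {a..b} f2"
    "\<And>t. t \<in> {a<..<b} \<Longrightarrow> (f has_real_derivative f1 t) (at t)"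
    "\<And>t. t \<in> {a<..<b} \<Longrightarrow> (f1 has_real_derivative f2 t) (at t)"
    "\<And>t. t \<in> {a<..<b} \<Longrightarrow> deriv f t = f1 t"
    "\<And>t. t \<in> {a<..<b} \<Longrightarrow> deriv (deriv f) t = f2 t"
proof -
  obtain f1 f2 where f: "\<And>t. t \<in> {a..b} \<Longrightarrow> (f has_real_derivative f1 t) (at t within {a..b})"
    "\<And>t. t \<in> {a..b} \<Longrightarrow> (f1 has_real_derivative f2 t) (at t within {a..b})" "continuous_on {a..b} f2"
    using assms(2) unfolding C2_on_def by blast
  have c: "continuous_on {a..b} f" "continuous_on {a..b} f1"
    using f(1,2) DERIV_continuous_on by blast+
  have d1: "(f has_real_derivative f1 t) (at t)" and d2: "(f1 has_real_derivative f2 t) (at t)"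
    if "t \<in> {a<..<b}" for t
    using f(1,2)[of t] that by (simp_all add: at_within_Icc_at)
  have e1: "deriv f t = f1 t" if "t \<in> {a<..<b}" for t
    using d1[OF that] by (rule DERIV_imp_deriv)
  have "(deriv f has_real_derivative f2 t) (at t)" if "t \<in> {a<..<b}" for t
    using d2[OF that] by (rule has_field_derivative_transform_within_open[of _ _ _ "{a<..<b}"])
      (use that e1 in auto)
  then have "deriv (deriv f) t = f2 t" if "t \<in> {a<..<b}" for t
    using that by (blast intro: DERIV_imp_deriv)
  with that c f(3) d1 d2 e1 show thesis by blast
qed

section \<open>Errors of the trapezoidal rule and of affine interpolation on a single
  interval\<close>

lemma L2_norm_on_mult_le:
  fixes p w :: "real \<Rightarrow> real"
  assumes "continuous_on {a..b} p" "continuous_on {a..b} w" and bd: "\<And>t. t \<in> {a..b} \<Longrightarrow> \<bar>p t\<bar> \<le> B"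
    and "0 \<le> B"
  shows "L2_norm_on {a..b} (\<lambda>t. p t * w t) \<le> B * L2_norm_on {a..b} w"
proof -
  have "integral {a..b} (\<lambda>t. (p t * w t)\<^sup>2) \<le> integral {a..b} (\<lambda>t. B\<^sup>2 * (w t)\<^sup>2)"
  proof (rule integral_le)
    show "(p t * w t)\<^sup>2 \<le> B\<^sup>2 * (w t)\<^sup>2" if "t \<in> {a..b}" for t
      unfolding power_mult_distrib
      using bd[OF that] by (intro mult_right_mono) (auto simp: abs_le_square_iff[symmetric])
  qed (intro integrable_continuous_interval continuous_intros assms)+
  also have "\<dots> = B\<^sup>2 * integral {a..b} (\<lambda>t. (w t)\<^sup>2)" by simp
  finally have "L2_norm_on {a..b} (\<lambda>t. p t * w t) \<le> sqrt (B\<^sup>2 * integral {a..b} (\<lambda>t. (w t)\<^sup>2))"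
    unfolding L2_norm_on_def by (rule real_sqrt_le_mono)
  also have "\<dots> = B * L2_norm_on {a..b} w"
    using \<open>0 \<le> B\<close> by (simp add: real_sqrt_mult L2_norm_on_def)
  finally show ?thesis .
qed

text \<open>Two integrations by parts give the error as minus the integral of
  \<open>p * (f * w)''\<close> with the Peano kernel \<open>p = (t - a) * (b - t) / 2\<close>. As
  \<open>w\<close> is affine, \<open>(f * w)'' = f'' * w + 2 * f' * \<beta>\<close>, and
  \<open>p\<close> is at most \<open>(b - a)^2 / 8\<close>, its value at the midpoint.\<close>

lemma trapezoidal_error:
  fixes f w :: "real \<Rightarrow> real"
  assumes "a < b" and "C2_on f {a..b}" and w: "\<And>t. t \<in> {a..b} \<Longrightarrow> w t = \<alpha> + \<beta> * t"
  shows "\<bar>integral {a..b} (\<lambda>t. f t * w t) - (b - a) / 2 * (f a * w a + f b * w b)\<bar> \<le>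
    (b - a)\<^sup>2 / 8 * L2_norm_on {a..b} (deriv (deriv f)) * L2_norm_on {a..b} w +
    (b - a)\<^sup>2 / 4 * L2_norm_on {a..b} (deriv f) * L2_norm_on {a..b} (\<lambda>_. \<beta>)"
proof -
  obtain f1 f2 where c: "continuous_on {a..b} f" "continuous_on {a..b} f1" "continuous_on {a..b} f2"
    and d: "\<And>t. t \<in> {a<..<b} \<Longrightarrow> (f has_real_derivative f1 t) (at t)"
      "\<And>t. t \<in> {a<..<b} \<Longrightarrow> (f1 has_real_derivative f2 t) (at t)"
    and e: "\<And>t. t \<in> {a<..<b} \<Longrightarrow> deriv f t = f1 t"
      "\<And>t. t \<in> {a<..<b} \<Longrightarrow> deriv (deriv f) t = f2 t"
    using C2_on_Icc_deriv[OF assms(1,2)] by blast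
  define v where "v t = \<alpha> + \<beta> * t" for t
  \<comment> \<open>\<open>m\<close> is the derivative of \<open>p\<close>, and that of
    \<open>m\<close> is -1. Hence \<open>P = p * (f * v)' - m * (f * v)\<close> has the derivative
    \<open>f * v + p * (f * v)''\<close>. Since \<open>p\<close> vanishes at both ends and
    \<open>m\<close> equals \<open>(b - a) / 2\<close> at \<open>a\<close> and its negative at
    \<open>b\<close>, the increment of \<open>P\<close> is the trapezoidal value.\<close>
  define p where "p t = (t - a) * (b - t) / 2" for t
  define m where "m t = (a + b - 2 * t) / 2" for t
  define P where "P t = p t * (f1 t * v t + f t * \<beta>) - m t * (f t * v t)" for t
  have vc: "continuous_on {a..b} v" unfolding v_def by (intro continuous_intros)
  have mc: "continuous_on {a..b} m" unfolding m_def by (intro continuous_intros) auto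
  have pc: "continuous_on {a..b} p" unfolding p_def by (intro continuous_intros) auto
  have "((\<lambda>t. f t * v t + (f2 t * (p t * v t) + f1 t * (2 * p t * \<beta>))) has_integral (P b - P a)) {a..b}"
  proof (rule fundamental_theorem_of_calculus_interior_strong[of "{}"])
    show "continuous_on {a..b} P"
      unfolding P_def by (intro continuous_intros c vc pc mc)
    show "(P has_vector_derivative f t * v t + (f2 t * (p t * v t) + f1 t * (2 * p t * \<beta>))) (at t)"
      if "t \<in> {a<..<b} - {}" for t
    proof -
      have t: "t \<in> {a<..<b}" using that by simp
      have D: "(v has_real_derivative \<beta>) (at t)" "(p has_real_derivative m t) (at t)"
        "(m has_real_derivative -1) (at t)"
        unfolding v_def p_def m_def by (auto intro!: derivative_eq_intros simp: field_simps)
      have "(P has_real_derivative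
         m t * (f1 t * v t + f t * \<beta>) + (f1 t * \<beta> + f2 t * v t + f1 t * \<beta>) * p t
         - (- (f t * v t) + (f t * \<beta> + f1 t * v t) * m t)) (at t)"
        unfolding P_def by (rule derivative_eq_intros d[OF t] D refl | simp add: algebra_simps)+
      moreover have "m t * (f1 t * v t + f t * \<beta>) + (f1 t * \<beta> + f2 t * v t + f1 t * \<beta>) * p t
         - (- (f t * v t) + (f t * \<beta> + f1 t * v t) * m t)
         = f t * v t + (f2 t * (p t * v t) + f1 t * (2 * p t * \<beta>))"
        by (simp add: algebra_simps)
      ultimately show ?thesis by (simp only: has_real_derivative_iff_has_vector_derivative)
    qed
  qed (use \<open>a < b\<close> in auto)
  moreover have "P b - P a = (b - a) / 2 * (f a * w a + f b * w b)"
    using w[of a] w[of b] \<open>a < b\<close> by (simp add: P_def p_def m_def v_def field_simps)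
  ultimately have "((\<lambda>t. f t * v t + (f2 t * (p t * v t) + f1 t * (2 * p t * \<beta>))) has_integral
      ((b - a) / 2 * (f a * w a + f b * w b))) {a..b}" by simp
  moreover have "((\<lambda>t. f t * v t + (f2 t * (p t * v t) + f1 t * (2 * p t * \<beta>))) has_integral
      (integral {a..b} (\<lambda>t. f t * v t) +
      (integral {a..b} (\<lambda>t. f2 t * (p t * v t)) + integral {a..b} (\<lambda>t. f1 t * (2 * p t * \<beta>))))) {a..b}"
    by (intro has_integral_add integrable_integral integrable_continuous_interval continuous_intros c vc pc)
  ultimately have *: "(b - a) / 2 * (f a * w a + f b * w b) = integral {a..b} (\<lambda>t. f t * v t) +
      (integral {a..b} (\<lambda>t. f2 t * (p t * v t)) + integral {a..b} (\<lambda>t. f1 t * (2 * p t * \<beta>)))"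
    by (rule has_integral_unique)
  have pb: "\<bar>p t\<bar> \<le> (b - a)\<^sup>2 / 8" if "t \<in> {a..b}" for t
  proof -
    have "0 \<le> p t" using that by (simp add: p_def)
    moreover have "(b - a)\<^sup>2 / 8 - p t = (2 * t - a - b)\<^sup>2 / 8"
      by (simp add: p_def power2_eq_square field_simps)
    ultimately show ?thesis using zero_le_power2[of "2 * t - a - b"] by linarith
  qed
  have E: "L2_norm_on {a..b} (deriv f) = L2_norm_on {a..b} f1"
    "L2_norm_on {a..b} (deriv (deriv f)) = L2_norm_on {a..b} f2"
    using e by (intro L2_norm_on_cong[of "{a, b}"]; force)+
  have W: "L2_norm_on {a..b} w = L2_norm_on {a..b} v"
    using w by (intro L2_norm_on_cong[of "{}"]) (auto simp: v_def)
  have "\<bar>integral {a..b} (\<lambda>t. f2 t * (p t * v t))\<bar> \<le> L2_norm_on {a..b} f2 * L2_norm_on {a..b} (\<lambda>t. p t * v t)"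
    by (intro abs_integral_mult_le integrable_continuous_interval continuous_intros c vc pc)
  also have "\<dots> \<le> L2_norm_on {a..b} f2 * ((b - a)\<^sup>2 / 8 * L2_norm_on {a..b} v)"
    by (intro mult_left_mono L2_norm_on_mult_le pc vc pb L2_norm_on_nonneg) auto
  finally have 1: "\<bar>integral {a..b} (\<lambda>t. f2 t * (p t * v t))\<bar> \<le>
    (b - a)\<^sup>2 / 8 * L2_norm_on {a..b} f2 * L2_norm_on {a..b} v" by (simp add: mult_ac)
  have "\<bar>integral {a..b} (\<lambda>t. f1 t * (2 * p t * \<beta>))\<bar> \<le> L2_norm_on {a..b} f1 * L2_norm_on {a..b} (\<lambda>t. 2 * p t * \<beta>)"
    by (intro abs_integral_mult_le integrable_continuous_interval continuous_intros c vc pc)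
  also have "\<dots> \<le> L2_norm_on {a..b} f1 * ((b - a)\<^sup>2 / 4 * L2_norm_on {a..b} (\<lambda>_. \<beta>))"
  proof (intro mult_left_mono L2_norm_on_mult_le continuous_intros pc L2_norm_on_nonneg)
    show "\<bar>2 * p t\<bar> \<le> (b - a)\<^sup>2 / 4" if "t \<in> {a..b}" for t using pb[OF that] by simp
  qed auto
  finally have 2: "\<bar>integral {a..b} (\<lambda>t. f1 t * (2 * p t * \<beta>))\<bar> \<le>
    (b - a)\<^sup>2 / 4 * L2_norm_on {a..b} f1 * L2_norm_on {a..b} (\<lambda>_. \<beta>)" by (simp add: mult_ac)
  have "integral {a..b} (\<lambda>t. f t * w t) = integral {a..b} (\<lambda>t. f t * v t)"
    using w by (intro integral_cong) (simp add: v_def)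
  with 1 2 * show ?thesis unfolding E W by linarith
qed

text \<open>The slope \<open>s\<close> is the mean of \<open>V'\<close>, so by orthogonality the
  squared norm of \<open>V' - s\<close> is that of \<open>V'\<close> minus
  \<open>s^2 * (b - a)\<close>. Nonnegativity gives the first claim. For the second, the
  interpolation error vanishes at both ends and \<open>wirtinger\<close> applies to it.\<close>

lemma affine_interpolation_error:
  fixes V V' :: "real \<Rightarrow> real"
  assumes "a < b" and "finite S" and cont: "continuous_on {a..b} V"
    and der: "\<And>t. t \<in> {a<..<b} - S \<Longrightarrow> (V has_real_derivative V' t) (at t)"
    and bd: "\<And>t. t \<in> {a<..<b} - S \<Longrightarrow> \<bar>V' t\<bar> \<le> M"
    and int: "(\<lambda>t. (V' t)\<^sup>2) integrable_on {a..b}"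
  defines "s \<equiv> (V b - V a) / (b - a)"
  shows "s\<^sup>2 * (b - a) \<le> (L2_norm_on {a..b} V')\<^sup>2"
    and "L2_norm_on {a..b} (\<lambda>t. V t - (V a + s * (t - a))) \<le> (b - a) / pi * L2_norm_on {a..b} V'"
proof -
  have sb: "V b - V a = s * (b - a)" using \<open>a < b\<close> by (simp add: s_def)
  have "(V' has_integral (V b - V a)) {a..b}"
    using assms(1,2) cont der
    by (intro fundamental_theorem_of_calculus_interior_strong[of S])
      (auto simp: has_real_derivative_iff_has_vector_derivative[symmetric])
  then have "((\<lambda>t. (V' t)\<^sup>2 - (2 * s) * V' t + s\<^sup>2) has_integral
      ((L2_norm_on {a..b} V')\<^sup>2 - (2 * s) * (V b - V a) + (b - a) * s\<^sup>2)) {a..b}"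
    unfolding L2_norm_on_sq using int \<open>a < b\<close> has_integral_const_real[of "s\<^sup>2" a b]
    by (intro has_integral_add has_integral_diff has_integral_mult_right integrable_integral) simp_all
  then have I: "((\<lambda>t. (V' t - s)\<^sup>2) has_integral ((L2_norm_on {a..b} V')\<^sup>2 - s\<^sup>2 * (b - a))) {a..b}"
    by (simp add: sb power2_eq_square algebra_simps)
  show "s\<^sup>2 * (b - a) \<le> (L2_norm_on {a..b} V')\<^sup>2"
    using has_integral_nonneg[OF I] by simp
  have "(L2_norm_on {a..b} (\<lambda>t. V' t - s))\<^sup>2 = (L2_norm_on {a..b} V')\<^sup>2 - s\<^sup>2 * (b - a)"
    unfolding L2_norm_on_sq[of _ "\<lambda>t. V' t - s"] by (rule integral_unique[OF I])
  also have "\<dots> \<le> (L2_norm_on {a..b} V')\<^sup>2" using \<open>a < b\<close> by simp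
  finally have le: "L2_norm_on {a..b} (\<lambda>t. V' t - s) \<le> L2_norm_on {a..b} V'"
    by (rule power2_le_imp_le) (rule L2_norm_on_nonneg)
  have "L2_norm_on {a..b} (\<lambda>t. V t - (V a + s * (t - a))) \<le> (b - a) / pi * L2_norm_on {a..b} (\<lambda>t. V' t - s)"
  proof (rule wirtinger[OF \<open>a < b\<close> \<open>finite S\<close>])
    show "continuous_on {a..b} (\<lambda>t. V t - (V a + s * (t - a)))" by (intro continuous_intros cont)
    show "((\<lambda>t. V t - (V a + s * (t - a))) has_real_derivative V' t - s) (at t)"
      if "t \<in> {a<..<b} - S" for t
      by (auto intro!: derivative_eq_intros der[OF that])
    show "\<bar>V' t - s\<bar> \<le> M + \<bar>s\<bar>" if "t \<in> {a<..<b} - S" for t using bd[OF that] by linarith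
    show "(\<lambda>t. (V' t - s)\<^sup>2) integrable_on {a..b}" using I by blast
  qed (use sb in auto)
  also have "\<dots> \<le> (b - a) / pi * L2_norm_on {a..b} V'"
    using le \<open>a < b\<close> by (intro mult_left_mono) auto
  finally show "L2_norm_on {a..b} (\<lambda>t. V t - (V a + s * (t - a))) \<le> (b - a) / pi * L2_norm_on {a..b} V'" .
qed

lemma sum_mult_le_sqrt:
  fixes a b :: "'i \<Rightarrow> real"
  shows "(\<Sum>i\<in>I. a i * b i) \<le> sqrt (\<Sum>i\<in>I. (a i)\<^sup>2) * sqrt (\<Sum>i\<in>I. (b i)\<^sup>2)"
proof -
  have "(\<Sum>i\<in>I. a i * b i) \<le> (\<Sum>i\<in>I. \<bar>a i\<bar> * \<bar>b i\<bar>)"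
    by (intro sum_mono) (metis abs_ge_self abs_mult)
  also have "\<dots> \<le> sqrt (\<Sum>i\<in>I. (a i)\<^sup>2) * sqrt (\<Sum>i\<in>I. (b i)\<^sup>2)"
    using L2_set_mult_ineq[of a b I] by (simp add: L2_set_def)
  finally show ?thesis .
qed

subsection \<open>Piecewise affine interpolation\<close>

definition slope :: "(int \<Rightarrow> real) \<Rightarrow> (int \<Rightarrow> real) \<Rightarrow> int \<Rightarrow> real" where
  "slope x c k = (c k - c (k - 1)) / len x k"

text \<open>The hypotheses of \<open>pw_affine_ex1\<close>. Both the finite element mesh and the
  lattice are instances, so each fact below serves both interpolants.\<close>

locale mesh =
  fixes x :: "int \<Rightarrow> real"
  assumes strict: "strict_mono x" and cover: "(\<Union>k. elem x k) = UNIV"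
begin

lemma node_less: "x (k - 1) < x k"
  using strict by (simp add: strict_mono_def)

lemma node_le_iff: "x i \<le> x j \<longleftrightarrow> i \<le> j"
  using strict by (rule strict_mono_less_eq)

lemma node_less_iff: "x i < x j \<longleftrightarrow> i < j"
  using strict by (rule strict_mono_less)

lemma len_pos: "0 < len x k"
  using node_less[of k] by (simp add: len_def)

lemma elem_exists: "\<exists>k. t \<in> elem x k"
  using cover by blast

text \<open>Element \<open>k\<close> ends at node \<open>k\<close>, so the half-open index range is
  the one whose elements fill the interval between nodes \<open>p\<close> and \<open>q\<close>. The
  form with \<open>has_integral\<close> delivers integrability along with the value.\<close>

lemma has_integral_elems:
  fixes g :: "real \<Rightarrow> real"
  assumes "p \<le> q" and "\<And>k. k \<in> {p<..q} \<Longrightarrow> (g has_integral I k) (elem x k)"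
  shows "(g has_integral (\<Sum>k\<in>{p<..q}. I k)) {x p..x q}"
  using assms
proof (induction q rule: int_ge_induct)
  case base
  then show ?case using has_integral_refl(2)[of g "x p"] by simp
next
  case (step q)
  have "(g has_integral (\<Sum>k\<in>{p<..q}. I k) + I (q + 1)) {x p..x (q + 1)}"
  proof (rule has_integral_combine)
    show "(g has_integral (\<Sum>k\<in>{p<..q}. I k)) {x p..x q}" using step.IH step.prems by auto
    show "(g has_integral I (q + 1)) {x q..x (q + 1)}"
      using step.prems[of "q + 1"] step.hyps by (simp add: elem_def)
  qed (use step.hyps in \<open>auto simp: node_le_iff\<close>)
  moreover have "{p<..q + 1} = insert (q + 1) {p<..q}" using step.hyps by auto
  ultimately show ?case by (simp add: add.commute)
qed

context
  fixes c :: "int \<Rightarrow> real"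
begin

lemma interp: "pw_affine x c \<in> P1 x" "pw_affine x c (x k) = c k"
  using theI'[OF pw_affine_ex1[OF strict cover, of c]] by (simp_all add: pw_affine_def)

lemma interp_continuous: "continuous_on S (pw_affine x c)"
  using interp(1) by (auto simp: P1_def intro: continuous_on_subset)

lemma interp_eq:
  assumes "t \<in> elem x k"
  shows "pw_affine x c t = c (k - 1) + slope x c k * (t - x (k - 1))"
proof -
  obtain a b where ab: "\<forall>t\<in>elem x k. pw_affine x c t = a + b * t"
    using interp(1) unfolding P1_def by blast
  have e: "c (k - 1) = a + b * x (k - 1)" "c k = a + b * x k"
    using ab[rule_format, of "x (k - 1)"] ab[rule_format, of "x k"] node_less[of k]
    by (simp_all add: elem_def interp(2))
  have "slope x c k = b"
    using node_less[of k] by (simp add: slope_def len_def e right_diff_distrib[symmetric])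
  then show ?thesis using ab assms by (simp add: e algebra_simps)
qed

lemma interp_has_derivative:
  assumes "t \<in> {x (k - 1)<..<x k}"
  shows "(pw_affine x c has_real_derivative slope x c k) (at t)"
proof -
  have "((\<lambda>t. c (k - 1) + slope x c k * (t - x (k - 1))) has_real_derivative slope x c k) (at t)"
    by (auto intro!: derivative_eq_intros)
  then show ?thesis
    by (rule has_field_derivative_transform_within_open[of _ _ _ "{x (k - 1)<..<x k}"])
      (use assms interp_eq[of _ k] in \<open>auto simp: elem_def\<close>)
qed

lemma deriv_interp: "t \<in> {x (k - 1)<..<x k} \<Longrightarrow> deriv (pw_affine x c) t = slope x c k"
  using interp_has_derivative by (rule DERIV_imp_deriv)

lemma interp_has_deriv:
  assumes "t \<notin> range x"
  shows "(pw_affine x c has_real_derivative deriv (pw_affine x c) t) (at t)"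
proof -
  obtain k where "t \<in> elem x k" using elem_exists by blast
  then have "t \<in> {x (k - 1)<..<x k}" using assms by (auto simp: elem_def less_le)
  then show ?thesis using interp_has_derivative deriv_interp by metis
qed

text \<open>The trapezoidal value; it turns weighted sums of nodal values into integrals of
  interpolants.\<close>

lemma interp_has_integral: "(pw_affine x c has_integral len x k / 2 * (c (k - 1) + c k)) (elem x k)"
proof -
  define P where "P t = c (k - 1) * t + slope x c k * (t - x (k - 1))\<^sup>2 / 2" for t
  have "((\<lambda>t. c (k - 1) + slope x c k * (t - x (k - 1))) has_integral (P (x k) - P (x (k - 1)))) {x (k - 1)..x k}"
  proof (rule fundamental_theorem_of_calculus)
    show "(P has_vector_derivative c (k - 1) + slope x c k * (t - x (k - 1))) (at t within {x (k - 1)..x k})" for t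
      unfolding P_def has_real_derivative_iff_has_vector_derivative[symmetric]
      by (auto intro!: derivative_eq_intros)
  qed (use node_less[of k] in simp)
  moreover have "P (x k) - P (x (k - 1)) = len x k / 2 * (c (k - 1) + c k)"
  proof -
    have "slope x c k * len x k = c k - c (k - 1)" using len_pos[of k] by (simp add: slope_def)
    moreover have "P (x k) - P (x (k - 1)) = c (k - 1) * len x k + (slope x c k * len x k) * len x k / 2"
      by (simp add: P_def len_def power2_eq_square algebra_simps)
    ultimately show ?thesis by (simp only:) (simp add: right_diff_distrib diff_divide_distrib algebra_simps)
  qed
  ultimately have "((\<lambda>t. c (k - 1) + slope x c k * (t - x (k - 1))) has_integral
      len x k / 2 * (c (k - 1) + c k)) (elem x k)" by (simp only: elem_def)
  then show ?thesis by (rule has_integral_eq[rotated]) (simp add: interp_eq)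
qed

lemma deriv_sq_has_integral: "((\<lambda>t. (deriv (pw_affine x c) t)\<^sup>2) has_integral (slope x c k)\<^sup>2 * len x k) (elem x k)"
proof -
  have "((\<lambda>_. (slope x c k)\<^sup>2) has_integral (slope x c k)\<^sup>2 * len x k) (elem x k)"
    using has_integral_const_real[of "(slope x c k)\<^sup>2" "x (k - 1)" "x k"] node_less[of k]
    by (simp add: elem_def len_def mult.commute)
  then show ?thesis
    by (rule has_integral_spike_finite[of "{x (k - 1), x k}", rotated 2])
      (auto simp: elem_def deriv_interp[of _ k])
qed

lemma energy:
  assumes "p \<le> q"
  shows "((\<lambda>t. (deriv (pw_affine x c) t)\<^sup>2) has_integral (\<Sum>k\<in>{p<..q}. (slope x c k)\<^sup>2 * len x k)) {x p..x q}"
  using assms deriv_sq_has_integral by (rule has_integral_elems)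

lemma interp_L2:
  assumes "p \<le> q"
  shows "(L2_norm_on {x p..x q} (pw_affine x c))\<^sup>2 = (\<Sum>k\<in>{p<..q}. (L2_norm_on (elem x k) (pw_affine x c))\<^sup>2)"
  unfolding L2_norm_on_sq elem_def
  by (intro integral_unique has_integral_elems[OF assms, unfolded elem_def] integrable_integral
    integrable_continuous_interval continuous_intros interp_continuous)

text \<open>Only finitely many elements lie between the two nodes, and the sum of their absolute
  slopes bounds each one. Nodes are excluded because the interpolant may have a kink there.\<close>

lemma interp_deriv_bounded:
  obtains M where "\<And>t. t \<in> {x p..x q} - x ` {p..q} \<Longrightarrow> \<bar>deriv (pw_affine x c) t\<bar> \<le> M"
proof
  fix t assume t: "t \<in> {x p..x q} - x ` {p..q}"
  obtain k where "t \<in> elem x k" using elem_exists by blast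
  then have k: "x (k - 1) \<le> t" "t \<le> x k" by (auto simp: elem_def)
  then have "x (k - 1) \<le> x q" "x p \<le> x k" using t by auto
  then have kk: "k - 1 \<le> q" "p \<le> k" by (auto simp: node_le_iff)
  have ne: "t \<noteq> x j" if "p \<le> j" "j \<le> q" for j using t that by auto
  have "x p \<le> x q" using t by auto
  then have pq: "p \<le> q" by (simp add: node_le_iff)
  \<comment> \<open>The elements with index \<open>p\<close> and \<open>q + 1\<close> meet the range
    only in a node, and \<open>t\<close> is not a node.\<close>
  have "k \<noteq> p" using ne[of p] k t pq by auto
  moreover have "k - 1 \<noteq> q" using ne[of q] k t pq by auto
  ultimately have kr: "k \<in> {p<..q}" using kk by auto
  then have "t \<noteq> x k" "t \<noteq> x (k - 1)" using ne by auto
  then have "deriv (pw_affine x c) t = slope x c k" using k by (intro deriv_interp) auto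
  then show "\<bar>deriv (pw_affine x c) t\<bar> \<le> (\<Sum>k\<in>{p<..q}. \<bar>slope x c k\<bar>)"
    using kr by (auto intro!: member_le_sum)
qed

lemma interp_poincare:
  assumes "p < q" "c p = 0" "c q = 0"
  shows "L2_norm_on {x p..x q} (pw_affine x c) \<le> (x q - x p) / pi * L2_norm_on {x p..x q} (deriv (pw_affine x c))"
proof -
  obtain M where M: "\<And>t. t \<in> {x p..x q} - x ` {p..q} \<Longrightarrow> \<bar>deriv (pw_affine x c) t\<bar> \<le> M"
    using interp_deriv_bounded by blast
  show ?thesis
  proof (rule wirtinger)
    show "(pw_affine x c has_real_derivative deriv (pw_affine x c) t) (at t)"
      if "t \<in> {x p<..<x q} - x ` {p..q}" for t
      using that by (intro interp_has_deriv) (auto simp: node_less_iff)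
    show "(\<lambda>t. (deriv (pw_affine x c) t)\<^sup>2) integrable_on {x p..x q}"
      using has_integral_integrable[OF energy[of p q]] assms(1) by simp
    show "\<bar>deriv (pw_affine x c) t\<bar> \<le> M" if "t \<in> {x p<..<x q} - x ` {p..q}" for t
      using that by (intro M) auto
  qed (use assms in \<open>auto simp: node_less_iff interp interp_continuous\<close>)
qed

text \<open>Here \<open>a\<close> and \<open>b\<close> may be arbitrary points between two nodes:
  the lattice interpolant is later compared with its affine interpolant on a mesh element whose ends
  may lie off the lattice.\<close>

lemma interp_coarse:
  assumes "x p \<le> a" "a < b" "b \<le> x q"
  defines "V \<equiv> pw_affine x c" and "s \<equiv> (pw_affine x c b - pw_affine x c a) / (b - a)"
  shows "s\<^sup>2 * (b - a) \<le> (L2_norm_on {a..b} (deriv V))\<^sup>2"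
    and "L2_norm_on {a..b} (\<lambda>t. V t - (V a + s * (t - a))) \<le> (b - a) / pi * L2_norm_on {a..b} (deriv V)"
proof -
  have sub: "{a..b} \<subseteq> {x p..x q}" using assms by auto
  have pq: "p \<le> q" using assms node_le_iff[of p q] by linarith
  obtain M where M: "\<And>t. t \<in> {x p..x q} - x ` {p..q} \<Longrightarrow> \<bar>deriv V t\<bar> \<le> M"
    unfolding V_def using interp_deriv_bounded by blast
  have der: "(V has_real_derivative deriv V t) (at t)" if "t \<in> {a<..<b} - x ` {p..q}" for t
    unfolding V_def
  proof (rule interp_has_deriv)
    have "x p < t" "t < x q" using that assms by auto
    then show "t \<notin> range x" using that by (auto simp: node_less_iff)
  qed
  have bd: "\<bar>deriv V t\<bar> \<le> M" if "t \<in> {a<..<b} - x ` {p..q}" for t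
    using that sub by (intro M) auto
  have int: "(\<lambda>t. (deriv V t)\<^sup>2) integrable_on {a..b}"
    unfolding V_def by (rule integrable_on_subinterval[OF has_integral_integrable[OF energy[OF pq]] sub])
  have ct: "continuous_on {a..b} V" unfolding V_def by (rule interp_continuous)
  have fin: "finite (x ` {p..q})" by simp
  note * = affine_interpolation_error[OF \<open>a < b\<close> fin ct der bd int]
  show "s\<^sup>2 * (b - a) \<le> (L2_norm_on {a..b} (deriv V))\<^sup>2"
    using *(1) by (simp add: s_def V_def)
  show "L2_norm_on {a..b} (\<lambda>t. V t - (V a + s * (t - a))) \<le> (b - a) / pi * L2_norm_on {a..b} (deriv V)"
    using *(2) by (simp add: s_def V_def)
qed

end

end

text \<open>Sums \<open>trapezoidal_error\<close> over the elements inside \<open>D\<close>, in a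
  form that serves lattice and mesh alike. The dichotomy in the hypothesis makes the integrand, cut
  off outside \<open>D\<close>, split elementwise. Cauchy-Schwarz over the elements then leaves the
  norm of \<open>w\<close>, bounded by the Poincare inequality, and the norm of its slopes.\<close>

lemma (in mesh) quadrature_error:
  fixes c :: "int \<Rightarrow> real" and f :: "real \<Rightarrow> real"
  defines "w \<equiv> pw_affine x c"
  assumes pq: "p < q" and unit: "x q = x p + 1" and zero: "c p = 0" "c q = 0"
    and contf: "continuous_on UNIV f"
    and D: "\<And>k. k \<in> {p<..q} \<Longrightarrow>
      elem x k \<subseteq> D \<and> C2_on f (elem x k) \<or> {x (k - 1)<..<x k} \<inter> D = {}"
  defines "G \<equiv> {k \<in> {p<..q}. elem x k \<subseteq> D}"
  obtains E where
    "((\<lambda>t. if t \<in> D then f t * w t - pw_affine x (\<lambda>k. f (x k) * c k) t else 0) has_integral E) {x p..x q}"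
    "\<bar>E\<bar> \<le> (sqrt (\<Sum>k\<in>G. len x k ^ 4 * (L2_norm_on (elem x k) (deriv (deriv f)))\<^sup>2) / (8 * pi) +
      sqrt (\<Sum>k\<in>G. len x k ^ 4 * (L2_norm_on (elem x k) (deriv f))\<^sup>2) / 4) *
      L2_norm_on {x p..x q} (deriv w)"
proof -
  define F1 F2 W S where "F1 k = L2_norm_on (elem x k) (deriv f)"
    and "F2 k = L2_norm_on (elem x k) (deriv (deriv f))"
    and "W k = L2_norm_on (elem x k) w" and "S k = L2_norm_on (elem x k) (\<lambda>_. slope x c k)" for k
  note defs = F1_def F2_def W_def S_def
  define e where "e k = integral (elem x k) (\<lambda>t. f t * w t)
    - len x k / 2 * (f (x (k - 1)) * c (k - 1) + f (x k) * c k)" for k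
  have eb: "\<bar>e k\<bar> \<le> (len x k)\<^sup>2 / 8 * F2 k * W k + (len x k)\<^sup>2 / 4 * F1 k * S k" if "k \<in> G" for k
  proof -
    \<comment> \<open>The midpoint of an element inside \<open>D\<close> rules out the second
      alternative of the hypothesis.\<close>
    have "\<not> {x (k - 1)<..<x k} \<inter> D = {}"
    proof -
      have "(x (k - 1) + x k) / 2 \<in> {x (k - 1)<..<x k}" using node_less[of k] by simp
      moreover have "(x (k - 1) + x k) / 2 \<in> elem x k" using node_less[of k] by (simp add: elem_def)
      moreover have "elem x k \<subseteq> D" using that by (simp add: G_def)
      ultimately show ?thesis by blast
    qed
    then have "C2_on f (elem x k)" using that D by (auto simp: G_def)
    then show ?thesis
      using trapezoidal_error[of "x (k - 1)" "x k" f w "c (k - 1) - slope x c k * x (k - 1)" "slope x c k"]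
        node_less[of k] interp_eq[of _ k]
      by (simp add: e_def defs elem_def len_def w_def interp algebra_simps)
  qed
  have ei: "((\<lambda>t. if t \<in> D then f t * w t - pw_affine x (\<lambda>k. f (x k) * c k) t else 0)
      has_integral (if k \<in> G then e k else 0)) (elem x k)" if k: "k \<in> {p<..q}" for k
  proof (cases "k \<in> G")
    case True
    then have sub: "elem x k \<subseteq> D" by (simp add: G_def)
    have "((\<lambda>t. f t * w t - pw_affine x (\<lambda>k. f (x k) * c k) t) has_integral e k) (elem x k)"
      unfolding e_def
    proof (intro has_integral_diff integrable_integral)
      show "(\<lambda>t. f t * w t) integrable_on elem x k"
        unfolding elem_def w_def
        by (intro integrable_continuous_interval continuous_intros interp_continuous
            continuous_on_subset[OF contf]) auto
    qed (rule interp_has_integral)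
    then show ?thesis using sub True by (simp add: subset_iff cong: has_integral_cong)
  next
    case False
    then have "{x (k - 1)<..<x k} \<inter> D = {}" using D[OF k] k by (auto simp: G_def)
    then have "t \<notin> D" if "t \<in> elem x k - {x (k - 1), x k}" for t
      using that by (auto simp: elem_def less_le disjoint_iff)
    then have "((\<lambda>t. if t \<in> D then f t * w t - pw_affine x (\<lambda>k. f (x k) * c k) t else 0)
      has_integral 0) (elem x k)"
      by (intro has_integral_spike_finite[OF _ _ has_integral_0, of "{x (k - 1), x k}"]) simp_all
    then show ?thesis using False by simp
  qed
  have G: "G \<subseteq> {p<..q}" unfolding G_def by blast
  then have "finite G" by (rule finite_subset) simp
  note G = this G
  have pq': "p \<le> q" using pq by simp
  define L where "L = L2_norm_on {x p..x q} (deriv w)"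
  have L0: "0 \<le> L" unfolding L_def by (rule L2_norm_on_nonneg)
  \<comment> \<open>On a period of length 1 with zero end values the Poincare constant is
    \<open>1 / pi\<close>; the elements in \<open>G\<close> carry only part of the full
    norm.\<close>
  have WL: "sqrt (\<Sum>k\<in>G. (W k)\<^sup>2) \<le> L / pi"
  proof -
    have "(\<Sum>k\<in>G. (W k)\<^sup>2) \<le> (\<Sum>k\<in>{p<..q}. (W k)\<^sup>2)" using G by (intro sum_mono2) auto
    also have "\<dots> = (L2_norm_on {x p..x q} w)\<^sup>2" unfolding W_def w_def using interp_L2[OF pq'] by simp
    finally have "sqrt (\<Sum>k\<in>G. (W k)\<^sup>2) \<le> sqrt ((L2_norm_on {x p..x q} w)\<^sup>2)" by (rule real_sqrt_le_mono)
    also have "\<dots> \<le> L / pi"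
      using interp_poincare[OF pq zero] unit by (simp add: L_def w_def L2_norm_on_nonneg)
    finally show ?thesis .
  qed
  have SL: "sqrt (\<Sum>k\<in>G. (S k)\<^sup>2) \<le> L"
  proof -
    have S: "(S k)\<^sup>2 = (slope x c k)\<^sup>2 * len x k" for k
      using node_less[of k] by (simp add: S_def L2_norm_on_sq elem_def len_def)
    have "(\<Sum>k\<in>G. (S k)\<^sup>2) \<le> (\<Sum>k\<in>{p<..q}. (S k)\<^sup>2)" using G by (intro sum_mono2) auto
    also have "\<dots> = L\<^sup>2" unfolding L_def L2_norm_on_sq w_def S
      by (rule integral_unique[OF energy[OF pq'], symmetric])
    finally have "sqrt (\<Sum>k\<in>G. (S k)\<^sup>2) \<le> sqrt (L\<^sup>2)" by (rule real_sqrt_le_mono)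
    then show ?thesis using L0 by simp
  qed
  define Q where "Q F = sqrt (\<Sum>k\<in>G. len x k ^ 4 * (F k)\<^sup>2)" for F :: "int \<Rightarrow> real"
  have cs: "(\<Sum>k\<in>G. (len x k)\<^sup>2 * F k * H k) \<le> Q F * sqrt (\<Sum>k\<in>G. (H k)\<^sup>2)" for F H :: "int \<Rightarrow> real"
    using sum_mult_le_sqrt[of "\<lambda>k. (len x k)\<^sup>2 * F k" H G]
    by (simp add: Q_def power_mult_distrib flip: power_mult)
  have Q0: "0 \<le> Q F" for F unfolding Q_def by (intro real_sqrt_ge_zero sum_nonneg) auto
  have "\<bar>\<Sum>k\<in>{p<..q}. if k \<in> G then e k else 0\<bar> = \<bar>\<Sum>k\<in>G. e k\<bar>"
    using G by (simp add: sum.If_cases Int_absorb1)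
  also have "\<dots> \<le> (\<Sum>k\<in>G. (len x k)\<^sup>2 / 8 * F2 k * W k + (len x k)\<^sup>2 / 4 * F1 k * S k)"
    using eb by (intro order_trans[OF sum_abs] sum_mono)
  also have "\<dots> = (\<Sum>k\<in>G. (len x k)\<^sup>2 * F2 k * W k) / 8 + (\<Sum>k\<in>G. (len x k)\<^sup>2 * F1 k * S k) / 4"
    by (simp add: sum.distrib sum_divide_distrib)
  also have "\<dots> \<le> Q F2 * (L / pi) / 8 + Q F1 * L / 4"
    by (intro add_mono divide_right_mono order_trans[OF cs] mult_left_mono WL SL Q0) auto
  finally have "\<bar>\<Sum>k\<in>{p<..q}. if k \<in> G then e k else 0\<bar> \<le> (Q F2 / (8 * pi) + Q F1 / 4) * L"
    by (simp add: field_simps)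
  then show thesis
    using that[OF has_integral_elems[OF pq' ei]] by (simp add: Q_def defs L_def)
qed

subsection \<open>The extended continuum region\<close>

lemma periodic_of_int:
  fixes f :: "real \<Rightarrow> 'a"
  assumes "\<And>t. f (t + 1) = f t"
  shows "f (t + of_int m) = f t"
proof (induction m rule: int_induct[where k = 0])
  case (step1 i)
  then show ?case using assms[of "t + of_int i"] by (simp add: add_ac)
next
  case (step2 i)
  then show ?case using assms[of "t + of_int (i - 1)"] by simp
qed simp

lemma real_floor_bounds:
  fixes r :: real
  obtains j :: int where "of_int j \<le> r" "r < of_int j + 1"
proof
  show "of_int \<lfloor>r\<rfloor> \<le> r" "r < of_int \<lfloor>r\<rfloor> + 1" by linarith+
qed

section \<open>Lattice and mesh nodes, their integer translates, and the region they
  determine\<close>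

locale qc_setting =
  fixes N K :: nat and La Ra :: real and x :: "int \<Rightarrow> real"
  assumes N: "N \<ge> 1" and La: "-1/2 < La" and LR: "La < Ra" and Ra: "Ra < 1/2"
    and qc: "qc_mesh N La Ra K x"
begin

lemma eps_pos: "0 < eps N"
  using N by (simp add: eps_def)

lemma eps_mult: "2 * real N * eps N = 1"
  using N by (simp add: eps_def)

sublocale mesh x
  using qc by unfold_locales (simp_all add: qc_mesh_def)

sublocale lat: mesh "lattice N"
proof
  show "strict_mono (lattice N)"
    using eps_pos by (auto simp: strict_mono_def lattice_def)
  have "\<exists>l. t \<in> elem (lattice N) l" for t
  proof -
    obtain j :: int where "of_int j \<le> t / eps N" "t / eps N < of_int j + 1"
      by (rule real_floor_bounds)
    then have "t \<in> elem (lattice N) (j + 1)"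
      using eps_pos by (simp add: elem_def lattice_def field_simps)
    then show ?thesis ..
  qed
  then show "(\<Union>l. elem (lattice N) l) = UNIV" by blast
qed

lemma len_lattice: "len (lattice N) l = eps N"
  by (simp add: len_def lattice_def algebra_simps)

lemma lattice_shift: "lattice N (l + 2 * int N * m) = lattice N l + of_int m"
proof -
  have "lattice N (l + 2 * int N * m) = lattice N l + (2 * real N * eps N) * of_int m"
    by (simp add: lattice_def algebra_simps)
  then show ?thesis by (simp only: eps_mult mult_1)
qed

lemma node_shift: "x (k + int K * m) = x k + of_int m"
proof -
  have s: "x (k + int K) = x k + 1" for k using qc by (simp add: qc_mesh_def)
  show ?thesis
  proof (induction m rule: int_induct[where k = 0])
    case (step1 i)
    then show ?case using s[of "k + int K * i"] by (simp add: algebra_simps)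
  next
    case (step2 i)
    then show ?case using s[of "k + int K * (i - 1)"] by (simp add: algebra_simps)
  qed simp
qed

lemma lattice_pred_shift: "lattice N (l + 2 * int N * m - 1) = lattice N (l - 1) + of_int m"
proof -
  have "l + 2 * int N * m - 1 = (l - 1) + 2 * int N * m" by simp
  then show ?thesis by (simp only: lattice_shift)
qed

lemma range_node_shift: "t \<in> range x \<Longrightarrow> t + of_int m \<in> range x"
  using node_shift[symmetric, of _ m] by (elim imageE) (simp only: rangeI)

lemma range_lattice_shift: "t \<in> range (lattice N) \<Longrightarrow> t + of_int m \<in> range (lattice N)"
  using lattice_shift[symmetric, of _ m] by (elim imageE) (simp only: rangeI)

text \<open>Condition (T2) concerns the atomistic region itself; since both node sets are invariant
  under integer translations, it passes to all translates.\<close>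

lemma atomistic_nodes:
  assumes "La + of_int m < t" "t < Ra + of_int m"
  shows "t \<in> range (lattice N) \<longleftrightarrow> t \<in> range x"
proof -
  have "Omega_a La Ra \<inter> range (lattice N) = Omega_a La Ra \<inter> range x"
    using qc by (simp add: qc_mesh_def)
  moreover have "t - of_int m \<in> Omega_a La Ra" using assms by (simp add: Omega_a_def)
  ultimately have "t - of_int m \<in> range (lattice N) \<longleftrightarrow> t - of_int m \<in> range x" by blast
  moreover have "t \<in> range (lattice N) \<longleftrightarrow> t - of_int m \<in> range (lattice N)"
    using range_lattice_shift[of "t - of_int m" m] range_lattice_shift[of t "- m"] by auto
  moreover have "t \<in> range x \<longleftrightarrow> t - of_int m \<in> range x"
    using range_node_shift[of "t - of_int m" m] range_node_shift[of t "- m"] by auto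
  ultimately show ?thesis by blast
qed

text \<open>These are exactly the lattice intervals outside the extended continuum region.\<close>

definition atomistic :: "int \<Rightarrow> bool" where
  "atomistic l \<longleftrightarrow> (\<exists>m::int. La + of_int m \<le> lattice N (l - 1) \<and> lattice N l \<le> Ra + of_int m)"

lemma Omega_c_per_eq: "Omega_c_per La Ra = (\<Union>m::int. {of_int m - 1/2..La + of_int m} \<union> {Ra + of_int m..of_int m + 1/2})"
proof -
  have "Omega_c La Ra = {-1/2..La} \<union> {Ra..1/2}"
    using La LR Ra by (auto simp: Omega_c_def Omega_a_def)
  then have 1: "t - of_int m \<in> Omega_c La Ra \<longleftrightarrow>
      t \<in> {of_int m - 1/2..La + of_int m} \<union> {Ra + of_int m..of_int m + 1/2}" for t and m :: int
    by auto
  have 2: "t \<in> Omega_c_per La Ra \<longleftrightarrow> (\<exists>m::int. t - of_int m \<in> Omega_c La Ra)" for t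
    unfolding Omega_c_per_def mem_Collect_eq by (metis add_diff_cancel_right' diff_add_cancel)
  show ?thesis by (rule set_eqI) (simp only: 1 2 UN_iff bex_UNIV)
qed

text \<open>Replaces the measure condition by inequalities between end points: an atomistic lattice
  interval misses the continuum region altogether, and any other one shares an open interval with
  it.\<close>

lemma measure_lat_int_pos_iff:
  "measure lborel (lat_int N l \<inter> Omega_c_per La Ra) > 0 \<longleftrightarrow> \<not> atomistic l"
proof
  assume pos: "measure lborel (lat_int N l \<inter> Omega_c_per La Ra) > 0"
  show "\<not> atomistic l"
  proof
    assume "atomistic l"
    then obtain m where m: "La + of_int m \<le> lattice N (l - 1)" "lattice N l \<le> Ra + of_int m"
      unfolding atomistic_def by blast
    have "lat_int N l \<inter> Omega_c_per La Ra = {}"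
    proof (rule ccontr)
      assume "lat_int N l \<inter> Omega_c_per La Ra \<noteq> {}"
      then obtain t j where t: "t \<in> lat_int N l"
        "t \<in> {of_int j - 1/2..La + of_int j} \<union> {Ra + of_int j..of_int j + 1/2}"
        unfolding Omega_c_per_eq by blast
      then have "of_int m < (of_int j + 1 :: real)" "of_int j < (of_int m + 1 :: real)"
        using m La Ra LR by (auto simp: lat_int_def)
      then have "j = m" by linarith
      then show False using t m by (auto simp: lat_int_def)
    qed
    then show False using pos by simp
  qed
next
  assume na: "\<not> atomistic l"
  \<comment> \<open>Selects the cell between consecutive half-integers that contains the left end.
    Half-integers are lattice points, so the lattice interval cannot reach beyond that cell, which
    is \<open>hi\<close>.\<close>
  define m where "m = \<lfloor>lattice N (l - 1) + 1/2\<rfloor>"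
  have less: "lattice N (l - 1) < lattice N l" by (rule lat.node_less)
  have lo: "of_int m - 1/2 \<le> lattice N (l - 1)" unfolding m_def by linarith
  have hi: "lattice N l \<le> of_int m + 1/2"
  proof -
    have half: "of_int m + 1/2 = lattice N (int N + 2 * int N * m)"
      unfolding lattice_shift using eps_mult by (simp add: lattice_def mult_ac)
    have "lattice N (l - 1) < of_int m + 1/2" unfolding m_def by linarith
    then have "l - 1 < int N + 2 * int N * m" unfolding half by (simp add: lat.node_less_iff)
    then show ?thesis unfolding half by (simp add: lat.node_le_iff)
  qed
  \<comment> \<open>Not being atomistic means, for this \<open>m\<close>, starting left of
    \<open>La + m\<close> or ending right of \<open>Ra + m\<close>; either overhang lies in the
    continuum region.\<close>
  obtain u v where uv: "u < v" "{u<..<v} \<subseteq> lat_int N l \<inter> Omega_c_per La Ra"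
  proof (cases "lattice N (l - 1) < La + of_int m")
    case True
    show thesis
    proof (rule that)
      show "lattice N (l - 1) < min (lattice N l) (La + of_int m)" using True less by simp
      show "{lattice N (l - 1)<..<min (lattice N l) (La + of_int m)} \<subseteq> lat_int N l \<inter> Omega_c_per La Ra"
      proof
        fix t assume t: "t \<in> {lattice N (l - 1)<..<min (lattice N l) (La + of_int m)}"
        then have "t \<in> {of_int m - 1/2..La + of_int m}" using lo by auto
        then have "t \<in> Omega_c_per La Ra" unfolding Omega_c_per_eq by blast
        then show "t \<in> lat_int N l \<inter> Omega_c_per La Ra" using t by (simp add: lat_int_def)
      qed
    qed
  next
    case False
    have F: "Ra + of_int m < lattice N l"
    proof (rule ccontr)
      assume "\<not> Ra + of_int m < lattice N l"
      then have "atomistic l" using False unfolding atomistic_def by (intro exI[of _ m]) simp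
      then show False using na by simp
    qed
    show thesis
    proof (rule that)
      show "max (lattice N (l - 1)) (Ra + of_int m) < lattice N l" using F less by simp
      show "{max (lattice N (l - 1)) (Ra + of_int m)<..<lattice N l} \<subseteq> lat_int N l \<inter> Omega_c_per La Ra"
      proof
        fix t assume t: "t \<in> {max (lattice N (l - 1)) (Ra + of_int m)<..<lattice N l}"
        then have "t \<in> {Ra + of_int m..of_int m + 1/2}" using hi by auto
        then have "t \<in> Omega_c_per La Ra" unfolding Omega_c_per_eq by blast
        then show "t \<in> lat_int N l \<inter> Omega_c_per La Ra" using t by (simp add: lat_int_def)
      qed
    qed
  qed
  have "0 < measure lborel {u<..<v}" using uv by simp
  also have "\<dots> \<le> measure lborel (lat_int N l \<inter> Omega_c_per La Ra)"
  proof (rule measure_mono_fmeasurable[OF uv(2)])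
    have "lat_int N l \<in> fmeasurable lborel"
      using less by (simp add: lat_int_def fmeasurable_def)
    moreover have "Omega_c_per La Ra \<in> sets lborel"
      unfolding Omega_c_per_eq by auto
    ultimately show "lat_int N l \<inter> Omega_c_per La Ra \<in> fmeasurable lborel"
      by (intro fmeasurable_Int_fmeasurable)
  qed auto
  finally show "measure lborel (lat_int N l \<inter> Omega_c_per La Ra) > 0" .
qed

abbreviation "\<Omega>\<^sub>c \<equiv> Omega_c_ext N La Ra"

lemma ext_eq: "\<Omega>\<^sub>c = (\<Union>l\<in>{l. \<not> atomistic l}. elem (lattice N) l)"
proof -
  have "closure (lat_int N l) = elem (lattice N) l" for l
    unfolding lat_int_def elem_def by (rule closure_greaterThanLessThan) (rule lat.node_less)
  then show ?thesis unfolding Omega_c_ext_def measure_lat_int_pos_iff by simp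
qed

lemma lattice_elem_ext: "\<not> atomistic l \<Longrightarrow> elem (lattice N) l \<subseteq> \<Omega>\<^sub>c"
  unfolding ext_eq by blast

text \<open>Distinct lattice elements overlap at most in an end point. Only the open interval is
  claimed, as an end point may belong to a neighbour inside the region.\<close>

lemma atomistic_disjoint:
  assumes "atomistic l"
  shows "{lattice N (l - 1)<..<lattice N l} \<inter> \<Omega>\<^sub>c = {}"
proof (rule ccontr)
  assume "{lattice N (l - 1)<..<lattice N l} \<inter> \<Omega>\<^sub>c \<noteq> {}"
  then obtain t j where t: "t \<in> {lattice N (l - 1)<..<lattice N l}" and j: "\<not> atomistic j"
    "t \<in> elem (lattice N) j" unfolding ext_eq by blast
  then have "lattice N (l - 1) < lattice N j" "lattice N (j - 1) < lattice N l"
    by (auto simp: elem_def)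
  then have "j = l" by (simp add: lat.node_less_iff)
  then show False using assms j by simp
qed

lemma atomistic_shift: "atomistic (l + 2 * int N * m) \<longleftrightarrow> atomistic l"
proof -
  have *: "atomistic (l + 2 * int N * m)" if "atomistic l" for l m
  proof -
    from that obtain j where "La + of_int j \<le> lattice N (l - 1)" "lattice N l \<le> Ra + of_int j"
      unfolding atomistic_def by blast
    then show ?thesis
      unfolding atomistic_def lattice_shift lattice_pred_shift by (intro exI[of _ "j + m"]) simp
  qed
  show ?thesis using *[of l m] *[of "l + 2 * int N * m" "- m"] by auto
qed

lemma ext_shift: "t + of_int m \<in> \<Omega>\<^sub>c \<longleftrightarrow> t \<in> \<Omega>\<^sub>c"
proof -
  have *: "t + of_int m \<in> \<Omega>\<^sub>c" if "t \<in> \<Omega>\<^sub>c" for t m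
  proof -
    from that obtain l where l: "\<not> atomistic l" "t \<in> elem (lattice N) l" unfolding ext_eq by blast
    then have "t + of_int m \<in> elem (lattice N) (l + 2 * int N * m)"
      unfolding elem_def lattice_shift lattice_pred_shift by simp
    then show ?thesis using l atomistic_shift[of l m] unfolding ext_eq by blast
  qed
  show ?thesis using *[of t m] *[of "t + of_int m" "- m"] by auto
qed

text \<open>Each end is either one of the translated interface points, a node by (T3), or strictly
  between them, a node by (T2). A further node in between would, again by (T2), be a lattice point
  strictly between two consecutive ones.\<close>

lemma atomistic_elem:
  assumes "atomistic l"
  obtains j where "x (j - 1) = lattice N (l - 1)" "x j = lattice N l"
proof -
  from assms obtain m where m: "La + of_int m \<le> lattice N (l - 1)" "lattice N l \<le> Ra + of_int m"
    unfolding atomistic_def by blast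
  have less: "lattice N (l - 1) < lattice N l" by (rule lat.node_less)
  have LRx: "La + of_int m \<in> range x" "Ra + of_int m \<in> range x"
    using qc range_node_shift by (auto simp: qc_mesh_def)
  have "lattice N (l - 1) \<in> range x"
    using m less LRx atomistic_nodes[of m "lattice N (l - 1)"]
    by (cases "La + of_int m = lattice N (l - 1)") auto
  moreover have "lattice N l \<in> range x"
    using m less LRx atomistic_nodes[of m "lattice N l"]
    by (cases "Ra + of_int m = lattice N l") auto
  ultimately obtain i j where ij: "x i = lattice N (l - 1)" "x j = lattice N l" by (metis imageE)
  then have "i < j" using less node_less_iff by metis
  have "j = i + 1"
  proof (rule ccontr)
    assume "j \<noteq> i + 1"
    then have b: "lattice N (l - 1) < x (i + 1)" "x (i + 1) < lattice N l"
      using \<open>i < j\<close> unfolding ij[symmetric] by (auto simp: node_less_iff)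
    then have "x (i + 1) \<in> range (lattice N)" using m atomistic_nodes[of m "x (i + 1)"] by simp
    then obtain l' where "x (i + 1) = lattice N l'" by blast
    then show False using b by (simp add: lat.node_less_iff)
  qed
  then show thesis using that[of j] ij by simp
qed

text \<open>A point of the element outside the region lies in an atomistic lattice interval, which
  is a mesh element by \<open>atomistic_elem\<close>. The lattice interval is chosen on the side of
  the point where the element continues, so that the two mesh elements overlap in more than an end
  point and hence coincide.\<close>

lemma elem_not_ext:
  assumes "\<not> elem x k \<subseteq> \<Omega>\<^sub>c"
  obtains l where "atomistic l" "x (k - 1) = lattice N (l - 1)" "x k = lattice N l"
proof -
  obtain t where "t \<in> elem x k" and "t \<notin> \<Omega>\<^sub>c" using assms by blast
  then have t: "x (k - 1) \<le> t" "t \<le> x k" "t \<notin> \<Omega>\<^sub>c" by (auto simp: elem_def)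
  show thesis
  proof (cases "t < x k")
    case True
    obtain j :: int where "of_int j \<le> t / eps N" "t / eps N < of_int j + 1"
      by (rule real_floor_bounds)
    moreover define l where "l = j + 1"
    ultimately have l: "lattice N (l - 1) \<le> t" "t < lattice N l"
      using eps_pos by (simp_all add: lattice_def field_simps)
    then have "t \<in> elem (lattice N) l" by (simp add: elem_def)
    then have al: "atomistic l" using t lattice_elem_ext[of l] by blast
    then obtain j where j: "x (j - 1) = lattice N (l - 1)" "x j = lattice N l" using atomistic_elem by blast
    then have "x (k - 1) < x j" "x (j - 1) < x k" using t l True by auto
    then have "j = k" by (simp add: node_less_iff)
    then show thesis using that al j by simp
  next
    case False
    \<comment> \<open>Rounding \<open>- t / eps N\<close> down yields a lattice interval open at the
      left, as required when \<open>t\<close> is the right end of the element.\<close>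
    obtain j :: int where "of_int j \<le> - t / eps N" "- t / eps N < of_int j + 1"
      by (rule real_floor_bounds)
    moreover define l where "l = - j"
    ultimately have l: "lattice N (l - 1) < t" "t \<le> lattice N l"
      using eps_pos by (simp_all add: lattice_def field_simps)
    then have "t \<in> elem (lattice N) l" by (simp add: elem_def)
    then have al: "atomistic l" using t lattice_elem_ext[of l] by blast
    then obtain j where j: "x (j - 1) = lattice N (l - 1)" "x j = lattice N l" using atomistic_elem by blast
    have "x (k - 1) < t" using False t node_less[of k] by simp
    then have "x (k - 1) < x j" "x (j - 1) < x k" using t l j False by auto
    then have "j = k" by (simp add: node_less_iff)
    then show thesis using that al j by simp
  qed
qed

text \<open>An interval of length at most 1 has at most one half-integer in its interior. Away from
  it the hypothesis on one period is translated; at it the two sides are joined by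
  \<open>C2_on_combine\<close>.\<close>

lemma C2_on_Icc:
  assumes per: "\<And>t. f (t + 1) = f t" and C2: "C2_on f (\<Omega>\<^sub>c \<inter> {-1/2..1/2})"
    and ab: "a < b" "b \<le> a + 1" "{a..b} \<subseteq> \<Omega>\<^sub>c"
    and half: "\<And>m::int. of_int m + 1/2 \<in> {a<..<b} \<Longrightarrow> \<exists>d>0. C2_on f {1/2 - d<..<1/2 + d}"
  shows "C2_on f {a..b}"
proof -
  have piece: "C2_on f {u..v}" if "{u..v} \<subseteq> \<Omega>\<^sub>c" "of_int m - 1/2 \<le> u" "v \<le> of_int m + 1/2" for u v and m :: int
  proof (rule C2_on_subset[OF C2_on_shift[OF C2 periodic_of_int[of f, OF per], of m]])
    show "{u..v} \<subseteq> {t. t - of_int m \<in> \<Omega>\<^sub>c \<inter> {-1/2..1/2}}"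
      using that ext_shift[of _ "- m"] by auto
  qed
  define m where "m = \<lfloor>a + 1/2\<rfloor>"
  have m: "of_int m - 1/2 \<le> a" "a < of_int m + 1/2" unfolding m_def by linarith+
  show ?thesis
  proof (cases "b \<le> of_int m + 1/2")
    case True
    then show ?thesis using piece m ab by blast
  next
    case False
    obtain d where d: "d > 0" "C2_on f {1/2 - d<..<1/2 + d}"
      using half[of m] m False by auto
    show ?thesis
    proof (rule C2_on_combine)
      show "a < of_int m + 1/2" "of_int m + 1/2 < b" using m False by auto
      show "C2_on f {a..of_int m + 1/2}" using ab False m by (intro piece[of _ _ m]) auto
      show "C2_on f {of_int m + 1/2..b}" using ab m by (intro piece[of _ _ "m + 1"]) auto
      show "d > 0" by fact
      show "C2_on f {of_int m + 1/2 - d<..<of_int m + 1/2 + d}"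
        by (rule C2_on_subset[OF C2_on_shift[OF d(2) periodic_of_int[of f, OF per], of m]]) auto
    qed
  qed
qed

end

subsection \<open>Residual estimate\<close>

lemma sum_periodic_int:
  fixes g :: "int \<Rightarrow> real"
  assumes per: "\<And>k. g (k + int K) = g k"
  shows "(\<Sum>k\<in>{p<..p + int K}. g k) = (\<Sum>k\<in>{r<..r + int K}. g k)"
proof (cases "K = 0")
  case False
  define h where "h p = (\<Sum>k\<in>{p<..p + int K}. g k)" for p
  have step: "h (p + 1) = h p" for p
  proof -
    have "{p<..p + int K} = insert (p + 1) {p + 1<..p + int K}"
      "{p + 1<..p + 1 + int K} = insert (p + 1 + int K) {p + 1<..p + int K}"
      using False by auto
    then show ?thesis using per[of "p + 1"] by (simp add: h_def)
  qed
  have "h p = h 0" for p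
  proof (induction p rule: int_induct[where k = 0])
    case (step1 i)
    then show ?case using step[of i] by simp
  next
    case (step2 i)
    then show ?case using step[of "i - 1"] by simp
  qed simp
  then show ?thesis unfolding h_def by metis
qed simp

text \<open>Moves from the period used in the definitions to the one whose ends are nodes of both
  meshes.\<close>

lemma integral_periodic:
  fixes h :: "real \<Rightarrow> real"
  assumes cont: "continuous_on UNIV h" and per: "\<And>t. h (t + 1) = h t"
  shows "integral {-1/2..1/2} h = integral {0..1} h"
proof -
  have i: "h integrable_on {a..b}" for a b
    by (rule integrable_continuous_interval) (rule continuous_on_subset[OF cont subset_UNIV])
  have "h \<circ> (+) 1 = h" using per by (auto simp: fun_eq_iff add.commute)
  then have "integral {-1/2..0} h = integral {1/2..1} h"
    using integral_shift_Icc_real[of "-1/2" 0 h 1] by simp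
  moreover have "integral {-1/2..0} h + integral {0..1/2} h = integral {-1/2..1/2} h"
    "integral {0..1/2} h + integral {1/2..1} h = integral {0..1} h"
    by (rule Henstock_Kurzweil_Integration.integral_combine; simp add: i)+
  ultimately show ?thesis by simp
qed

lemma L2_norm_on_shift:
  assumes "\<And>t. g (t + r) = g t"
  shows "L2_norm_on {a + r..b + r} g = L2_norm_on {a..b} g"
proof -
  have "(\<lambda>t. (g t)\<^sup>2) \<circ> (+) r = (\<lambda>t. (g t)\<^sup>2)" using assms by (auto simp: fun_eq_iff add.commute)
  then show ?thesis unfolding L2_norm_on_def using integral_shift_Icc_real[of a b "\<lambda>t. (g t)\<^sup>2" r] by simp
qed

lemma deriv_periodic:
  fixes f :: "real \<Rightarrow> real"
  assumes "\<And>t. f (t + r) = f t"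
  shows "deriv f (t + r) = deriv f t"
  unfolding deriv_def DERIV_shift assms ..

text \<open>Integrability is inherited from the continuous one-sided derivatives, from which the
  \<open>deriv\<close> terms can differ only at the two end points.\<close>

lemma C2_on_deriv_sq_integrable:
  fixes a b :: real
  assumes "a < b" "C2_on f {a..b}"
  shows "(\<lambda>t. (deriv f t)\<^sup>2) integrable_on {a..b}" "(\<lambda>t. (deriv (deriv f) t)\<^sup>2) integrable_on {a..b}"
proof -
  obtain f1 f2 where c: "continuous_on {a..b} f1" "continuous_on {a..b} f2"
    and e: "\<And>t. t \<in> {a<..<b} \<Longrightarrow> deriv f t = f1 t"
      "\<And>t. t \<in> {a<..<b} \<Longrightarrow> deriv (deriv f) t = f2 t"
    using C2_on_Icc_deriv[OF assms] by metis
  have i: "(\<lambda>t. (f1 t)\<^sup>2) integrable_on {a..b}" "(\<lambda>t. (f2 t)\<^sup>2) integrable_on {a..b}"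
    by (intro integrable_continuous_interval continuous_intros c)+
  show "(\<lambda>t. (deriv f t)\<^sup>2) integrable_on {a..b}" "(\<lambda>t. (deriv (deriv f) t)\<^sup>2) integrable_on {a..b}"
    by (rule integrable_spike_finite[of "{a, b}", OF _ _ i(1)], simp, simp add: e)
       (rule integrable_spike_finite[of "{a, b}", OF _ _ i(2)], simp, simp add: e)
qed

context mesh
begin

lemma interp_periodic:
  assumes xs: "\<And>k. x (k + m) = x k + 1" and cs: "\<And>k. c (k + m) = c k"
  shows "pw_affine x c (t + 1) = pw_affine x c t"
proof -
  obtain k where k: "t \<in> elem x k" using elem_exists by blast
  have e: "x (k + m - 1) = x (k - 1) + 1" "c (k + m - 1) = c (k - 1)"
    using xs[of "k - 1"] cs[of "k - 1"] by (simp_all add: algebra_simps)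
  have "t + 1 \<in> elem x (k + m)" using k by (simp add: elem_def e xs)
  from interp_eq[OF this, of c] interp_eq[OF k, of c] show ?thesis
    by (simp add: e xs cs slope_def len_def)
qed

text \<open>The integrand on the left does not depend on the mesh. Applied to the lattice and to the
  mesh it identifies the two sums of elementwise norms over the region.\<close>

lemma L2_split:
  assumes "p \<le> q"
    and int: "\<And>k. k \<in> {p<..q} \<Longrightarrow> elem x k \<subseteq> D \<Longrightarrow> (\<lambda>t. (g t)\<^sup>2) integrable_on elem x k"
    and disj: "\<And>k. k \<in> {p<..q} \<Longrightarrow> \<not> elem x k \<subseteq> D \<Longrightarrow> {x (k - 1)<..<x k} \<inter> D = {}"
  shows "((\<lambda>t. if t \<in> D then (g t)\<^sup>2 else 0) has_integral
    (\<Sum>k\<in>{k \<in> {p<..q}. elem x k \<subseteq> D}. (L2_norm_on (elem x k) g)\<^sup>2)) {x p..x q}"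
proof -
  have "((\<lambda>t. if t \<in> D then (g t)\<^sup>2 else 0) has_integral
    (if elem x k \<subseteq> D then (L2_norm_on (elem x k) g)\<^sup>2 else 0)) (elem x k)" if k: "k \<in> {p<..q}" for k
  proof (cases "elem x k \<subseteq> D")
    case True
    have "((\<lambda>t. (g t)\<^sup>2) has_integral (L2_norm_on (elem x k) g)\<^sup>2) (elem x k)"
      unfolding L2_norm_on_sq using int[OF k True] by (rule integrable_integral)
    then have "((\<lambda>t. if t \<in> D then (g t)\<^sup>2 else 0) has_integral (L2_norm_on (elem x k) g)\<^sup>2) (elem x k)"
      by (rule has_integral_eq[rotated]) (use True in auto)
    then show ?thesis using True by simp
  next
    case False
    then have "t \<notin> D" if "t \<in> elem x k - {x (k - 1), x k}" for t
      using disj[OF k] that by (auto simp: elem_def less_le disjoint_iff)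
    then have "((\<lambda>t. if t \<in> D then (g t)\<^sup>2 else 0) has_integral 0) (elem x k)"
      by (intro has_integral_spike_finite[OF _ _ has_integral_0, of "{x (k - 1), x k}"]) simp_all
    then show ?thesis using False by simp
  qed
  from has_integral_elems[OF assms(1) this] show ?thesis by (subst sum.inter_filter) simp_all
qed

end

section \<open>The residual for a fixed mesh and force\<close>

locale force = qc_setting +
  fixes f :: "real \<Rightarrow> real"
  assumes contf: "continuous_on UNIV f" and per: "\<And>t. f (t + 1) = f t" and C2: "C2_ext N La Ra x f"
begin

lemma K_pos: "K \<ge> 1"
proof (rule ccontr)
  assume "\<not> K \<ge> 1"
  then have "K = 0" by simp
  then show False using node_shift[of 0 1] by simp
qed

text \<open>If a half-integer lies strictly inside an element, then by periodicity 1/2 is no mesh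
  node, and this is when the hypothesis grants smoothness near 1/2.\<close>

lemma C2_elem:
  assumes "elem x k \<subseteq> \<Omega>\<^sub>c"
  shows "C2_on f (elem x k)"
  unfolding elem_def
proof (rule C2_on_Icc[of f, OF per])
  show "C2_on f (\<Omega>\<^sub>c \<inter> {-1/2..1/2})" using C2 by (simp add: C2_ext_def)
  show "x (k - 1) < x k" by (rule node_less)
  have "x k \<le> x (k - 1 + int K * 1)" using K_pos by (simp add: node_le_iff)
  then show "x k \<le> x (k - 1) + 1" by (simp only: node_shift)
  show "{x (k - 1)..x k} \<subseteq> \<Omega>\<^sub>c" using assms by (simp add: elem_def)
  fix m :: int assume m: "of_int m + 1/2 \<in> {x (k - 1)<..<x k}"
  have "1/2 \<notin> range x"
  proof
    assume "1/2 \<in> range x"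
    from range_node_shift[OF this, of m] obtain j where "of_int m + 1/2 = x j" by (auto simp: add.commute)
    then show False using m by (auto simp: node_less_iff)
  qed
  then show "\<exists>d>0. C2_on f {1/2 - d<..<1/2 + d}" using C2 by (simp add: C2_ext_def)
qed

text \<open>Half-integers are lattice points and so never interior to a lattice element.\<close>

lemma C2_lattice_elem:
  assumes "elem (lattice N) l \<subseteq> \<Omega>\<^sub>c"
  shows "C2_on f (elem (lattice N) l)"
  unfolding elem_def
proof (rule C2_on_Icc[of f, OF per])
  show "C2_on f (\<Omega>\<^sub>c \<inter> {-1/2..1/2})" using C2 by (simp add: C2_ext_def)
  show "lattice N (l - 1) < lattice N l" by (rule lat.node_less)
  have "lattice N l \<le> lattice N (l - 1 + 2 * int N * 1)" using N by (simp add: lat.node_le_iff)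
  then show "lattice N l \<le> lattice N (l - 1) + 1" by (simp only: lattice_shift)
  show "{lattice N (l - 1)..lattice N l} \<subseteq> \<Omega>\<^sub>c" using assms by (simp add: elem_def)
  fix m :: int assume m: "of_int m + 1/2 \<in> {lattice N (l - 1)<..<lattice N l}"
  have "of_int m + 1/2 = lattice N (int N + 2 * int N * m)"
    unfolding lattice_shift using eps_mult by (simp add: lattice_def mult_ac)
  with m have False by (auto simp: lat.node_less_iff)
  then show "\<exists>d>0. C2_on f {1/2 - d<..<1/2 + d}" ..
qed

lemma elem_disjoint: "\<not> elem x k \<subseteq> \<Omega>\<^sub>c \<Longrightarrow> {x (k - 1)<..<x k} \<inter> \<Omega>\<^sub>c = {}"
  using elem_not_ext atomistic_disjoint by metis

lemma lattice_elem_disjoint: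
  "\<not> elem (lattice N) l \<subseteq> \<Omega>\<^sub>c \<Longrightarrow> {lattice N (l - 1)<..<lattice N l} \<inter> \<Omega>\<^sub>c = {}"
  using lattice_elem_ext atomistic_disjoint by metis

lemma elem_ext_shift: "elem x (k + int K) \<subseteq> \<Omega>\<^sub>c \<longleftrightarrow> elem x k \<subseteq> \<Omega>\<^sub>c"
proof -
  have s: "x (k + int K) = x k + 1" "x (k + int K - 1) = x (k - 1) + 1"
    using node_shift[of k 1] node_shift[of "k - 1" 1] by (simp_all add: algebra_simps)
  have "elem x (k + int K) \<subseteq> \<Omega>\<^sub>c \<longleftrightarrow> (\<forall>t\<in>elem x k. t + of_int 1 \<in> \<Omega>\<^sub>c)"
  proof -
    have "elem x (k + int K) = (\<lambda>t. t + 1) ` elem x k" by (simp add: elem_def s)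
    then show ?thesis by auto
  qed
  then show ?thesis unfolding ext_shift by blast
qed

text \<open>The estimators number the elements from 1 to \<open>K\<close>; any other full period of
  indices gives the same sum, in particular one that starts at the node 0.\<close>

lemma sum_elems_ext:
  fixes g :: "int \<Rightarrow> real"
  assumes "\<And>k. g (k + int K) = g k"
  shows "(\<Sum>k\<in>elems_c_ext N La Ra K x. g k) = (\<Sum>k\<in>{k \<in> {p<..p + int K}. elem x k \<subseteq> \<Omega>\<^sub>c}. g k)"
proof -
  define h where "h k = (if elem x k \<subseteq> \<Omega>\<^sub>c then g k else 0)" for k
  have "h (k + int K) = h k" for k by (simp only: h_def elem_ext_shift assms)
  from sum_periodic_int[of h K, OF this, of 0 p]
  have "(\<Sum>k\<in>{1..int K}. h k) = (\<Sum>k\<in>{p<..p + int K}. h k)"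
    by (simp flip: atLeastPlusOneAtMost_greaterThanAtMost_int)
  then show ?thesis
    unfolding h_def elems_c_ext_def
    by (simp only: sum.inter_filter[OF finite_atLeastAtMost_int] sum.inter_filter[OF finite_greaterThanAtMost_int])
qed

lemma eta_periodic: "eta_f_sq x f (k + int K) = eta_f_sq x f k"
  "eta_q_sq N x f (k + int K) = eta_q_sq N x f k"
proof -
  have s: "x (k + int K) = x k + 1" "x (k + int K - 1) = x (k - 1) + 1"
    using node_shift[of k 1] node_shift[of "k - 1" 1] by (simp_all add: algebra_simps)
  have "L2_norm_on (elem x (k + int K)) g = L2_norm_on (elem x k) g" if "\<And>t. g (t + 1) = g t" for g
    unfolding elem_def s using that by (rule L2_norm_on_shift)
  note L = this[of f, OF per] this[of "deriv f", OF deriv_periodic[of f, OF per]]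
    this[of "deriv (deriv f)", OF deriv_periodic[of "deriv f", OF deriv_periodic[of f, OF per]]]
  have l: "len x (k + int K) = len x k" by (simp add: len_def s)
  show "eta_f_sq x f (k + int K) = eta_f_sq x f k" "eta_q_sq N x f (k + int K) = eta_q_sq N x f k"
    by (simp_all only: eta_f_sq_def eta_q_sq_def L l)
qed

lemma lattice_0: "lattice N 0 = 0" and lattice_2N: "lattice N (2 * int N) = 1"
  using eps_mult by (simp_all add: lattice_def mult_ac)

text \<open>The change of period is made on the sum of squared slopes, since
  \<open>integral_periodic\<close> asks for continuity and the derivative of an interpolant
  jumps.\<close>

lemma norm_U_sq:
  assumes v: "v \<in> U N"
  shows "(norm_U N v)\<^sup>2 = (\<Sum>l\<in>{0<..2 * int N}. (slope (lattice N) v l)\<^sup>2 * eps N)"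
proof -
  have h: "lattice N (- int N) = -1/2" "lattice N (int N) = 1/2"
    using eps_mult by (simp_all add: lattice_def mult_ac)
  have "(norm_U N v)\<^sup>2 = integral {-1/2..1/2} (\<lambda>t. (deriv (lat_fun N v) t)\<^sup>2)"
    by (simp add: norm_U_def L2_norm_on_sq integral_open_interval_real)
  also have "\<dots> = (\<Sum>l\<in>{- int N<..int N}. (slope (lattice N) v l)\<^sup>2 * eps N)"
    using integral_unique[OF lat.energy[of "- int N" "int N" v]]
    by (simp add: h lat_fun_def len_lattice)
  also have "\<dots> = (\<Sum>l\<in>{0<..2 * int N}. (slope (lattice N) v l)\<^sup>2 * eps N)"
  proof -
    have "v (l + int (2 * N)) = v l" for l using v by (simp add: U_def)
    from this[of "l - 1" for l] this have "slope (lattice N) v (l + int (2 * N)) = slope (lattice N) v l" for l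
      by (simp add: slope_def len_lattice algebra_simps)
    then show ?thesis
      using sum_periodic_int[of "\<lambda>l. (slope (lattice N) v l)\<^sup>2 * eps N" "2 * N" "- int N" 0] by simp
  qed
  finally show ?thesis .
qed

lemma norm_U_cell:
  assumes "v \<in> U N"
  shows "L2_norm_on {0..1} (deriv (lat_fun N v)) = norm_U N v"
proof -
  have "(L2_norm_on {0..1} (deriv (lat_fun N v)))\<^sup>2 = (norm_U N v)\<^sup>2"
    unfolding norm_U_sq[OF assms] L2_norm_on_sq
    using integral_unique[OF lat.energy[of 0 "2 * int N" v]]
    by (simp add: lattice_0 lattice_2N lat_fun_def len_lattice)
  then show ?thesis
    by (rule power2_eq_imp_eq) (simp_all add: norm_U_def L2_norm_on_nonneg)
qed

text \<open>Bounding a real supremum from above requires a nonempty set. The witness is a normalised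
  function that is 0 at multiples of \<open>2 * N\<close> and 1 elsewhere; its first slope is
  nonzero.\<close>

lemma unit_sphere_nonempty: "\<exists>v\<in>U N. norm_U N v = 1"
proof -
  define u :: "int \<Rightarrow> real" where "u l = (if 2 * int N dvd l then 0 else 1)" for l
  define S where "S = (\<Sum>l\<in>{0<..2 * int N}. (slope (lattice N) u l)\<^sup>2 * eps N)"
  have "\<not> 2 * int N dvd 1" by (metis dvd_mult_left odd_one)
  then have "slope (lattice N) u 1 = 1 / eps N" by (simp add: slope_def len_lattice u_def)
  then have "0 < (slope (lattice N) u 1)\<^sup>2 * eps N" using eps_pos by simp
  also have "\<dots> \<le> S" unfolding S_def
    using N eps_pos by (intro member_le_sum) auto
  finally have S: "0 < S" .
  define v where "v l = u l / sqrt S" for l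
  have vU: "v \<in> U N" by (auto simp: U_def v_def u_def)
  have sl: "slope (lattice N) v l = slope (lattice N) u l / sqrt S" for l
    by (simp add: slope_def v_def diff_divide_distrib mult.commute)
  have "(norm_U N v)\<^sup>2 = (\<Sum>l\<in>{0<..2 * int N}. (slope (lattice N) u l)\<^sup>2 * eps N / S)"
    unfolding norm_U_sq[OF vU] sl using S by (simp add: power_divide)
  also have "\<dots> = S / S" by (simp only: S_def sum_divide_distrib)
  finally have "(norm_U N v)\<^sup>2 = 1" using S by simp
  then have "norm_U N v = 1"
    by (rule power2_eq_imp_eq[of _ 1, simplified]) (simp_all add: norm_U_def L2_norm_on_nonneg)
  then show ?thesis using vU by blast
qed

text \<open>In the trapezoidal sum every value enters with weight one half from each adjacent
  element; periodicity makes the two half sums equal.\<close>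

lemma inner_eps_cell:
  assumes v: "v \<in> U N"
  shows "(pw_affine (lattice N) (\<lambda>l. f (lattice N l) * v l) has_integral inner_eps N f v) {0..1}"
proof -
  define g where "g l = f (lattice N l) * v l" for l
  have gper: "g (l + int (2 * N)) = g l" for l
    using v lattice_shift[of l 1] per by (simp add: g_def U_def)
  have "(\<Sum>l\<in>{0<..2 * int N}. g (l - 1)) = (\<Sum>l\<in>{-1<..2 * int N - 1}. g l)"
    by (rule sum.reindex_bij_witness[of _ "\<lambda>l. l + 1" "\<lambda>l. l - 1"]) auto
  also have "\<dots> = (\<Sum>l\<in>{0<..2 * int N}. g l)"
    using sum_periodic_int[of g "2 * N" "-1" 0, OF gper] by simp
  finally have a: "(\<Sum>l\<in>{0<..2 * int N}. g (l - 1)) = (\<Sum>l\<in>{0<..2 * int N}. g l)" .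
  have b: "(\<Sum>l\<in>{0<..2 * int N}. g l) = (\<Sum>l\<in>{- int N + 1..int N}. g l)"
    using sum_periodic_int[of g "2 * N" 0 "- int N", OF gper]
    by (simp flip: atLeastPlusOneAtMost_greaterThanAtMost_int)
  have "(pw_affine (lattice N) g has_integral (\<Sum>l\<in>{0<..2 * int N}. eps N / 2 * (g (l - 1) + g l))) {0..1}"
    using lat.has_integral_elems[of 0 "2 * int N", OF _ lat.interp_has_integral[of g]]
    by (simp add: lattice_0 lattice_2N len_lattice)
  moreover have "(\<Sum>l\<in>{0<..2 * int N}. eps N / 2 * (g (l - 1) + g l)) = inner_eps N f v"
    unfolding sum_distrib_left[symmetric] sum.distrib a b by (simp add: inner_eps_def g_def)
  ultimately show ?thesis by (simp add: g_def[abs_def])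
qed

lemma R_ext_le:
  assumes v: "v \<in> U N" and nv: "norm_U N v = 1"
  shows "R_ext N x f v \<le> eta_f N La Ra K x f + eta_q N La Ra K x f"
proof -
  \<comment> \<open>Starting at the node 0, the elements \<open>p + 1\<close> to
    \<open>p + K\<close> fill the interval from 0 to 1.\<close>
  obtain p where p: "x p = 0" using qc by (auto simp: qc_mesh_def)
  define q where "q = p + int K"
  have xq: "x q = 1" using node_shift[of p 1] p by (simp add: q_def)
  have pq: "p < q" using K_pos by (simp add: q_def)
  have cell: "{x p..x q} = {0..1}" "{lattice N 0..lattice N (2 * int N)} = {0..1}"
    by (simp_all add: p xq lattice_0 lattice_2N)
  define V where "V = lat_fun N v"
  define c where "c k = V (x k)" for k
  define W where "W = pw_affine x c"
  define IE where "IE = pw_affine (lattice N) (\<lambda>l. f (lattice N l) * v l)"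
  define IH where "IH = pw_affine x (\<lambda>k. f (x k) * c k)"
  have Vl: "V (lattice N l) = v l" for l by (simp add: V_def lat_fun_def lat.interp)
  have v0: "v 0 = 0" "v (2 * int N) = 0" using v by (auto simp: U_def dest: spec[of _ 0])
  have c0: "c p = 0" "c q = 0"
    using Vl[of 0] Vl[of "2 * int N"] by (simp_all add: c_def p xq lattice_0 lattice_2N v0)
  have Vper: "V (t + 1) = V t" for t
    unfolding V_def lat_fun_def
    using lattice_shift[of _ 1] v by (intro lat.interp_periodic[of "2 * int N"]) (simp_all add: U_def)
  have cont: "continuous_on S V" "continuous_on S W" "continuous_on S IE" "continuous_on S IH" for S
    unfolding V_def lat_fun_def W_def IE_def IH_def by (rule lat.interp_continuous interp_continuous)+
  have xs: "x (k + int K) = x k + 1" for k using node_shift[of k 1] by simp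
  have IHper: "IH (t + 1) = IH t" for t
    unfolding IH_def by (rule interp_periodic[of "int K"]) (simp_all add: xs c_def per Vper)
  have R: "R_ext N x f v = integral {0..1} IE - integral {0..1} IH"
  proof -
    have "inner_h x f W = integral {-1/2..1/2} IH"
      unfolding inner_h_def nodal_interp_def IH_def W_def by (simp add: interp)
    also have "\<dots> = integral {0..1} IH" by (rule integral_periodic[OF cont(4) IHper])
    finally have "inner_h x f W = integral {0..1} IH" .
    moreover have "nodal_interp x (lat_fun N v) = W"
      unfolding nodal_interp_def W_def c_def V_def ..
    ultimately show ?thesis
      unfolding R_ext_def IE_def using integral_unique[OF inner_eps_cell[OF v]] by simp
  qed

  define G where "G = {k \<in> {p<..q}. elem x k \<subseteq> \<Omega>\<^sub>c}"
  define G' where "G' = {l \<in> {0<..2 * int N}. elem (lattice N) l \<subseteq> \<Omega>\<^sub>c}"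
  have Vint: "(\<lambda>t. (deriv V t)\<^sup>2) integrable_on {0..1}"
    using has_integral_integrable[OF lat.energy[of 0 "2 * int N" v]]
    by (simp add: V_def lat_fun_def lattice_0 lattice_2N)
  have Vnorm: "L2_norm_on {0..1} (deriv V) = 1" using norm_U_cell[OF v] nv by (simp add: V_def)
  have in01: "0 \<le> x (k - 1)" "x k \<le> 1" if "k \<in> {p<..q}" for k
    using that unfolding p[symmetric] xq[symmetric] node_le_iff by auto
  have Vsum: "(\<Sum>k\<in>{p<..q}. (L2_norm_on (elem x k) (deriv V))\<^sup>2) = 1"
  proof -
    have "((\<lambda>t. (deriv V t)\<^sup>2) has_integral (L2_norm_on (elem x k) (deriv V))\<^sup>2) (elem x k)"
      if "k \<in> {p<..q}" for k
      unfolding L2_norm_on_sq elem_def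
      by (intro integrable_integral integrable_on_subinterval[OF Vint]) (use in01[OF that] in auto)
    from integral_unique[OF has_integral_elems[OF less_imp_le[OF pq] this]]
    show ?thesis using Vnorm by (simp add: cell flip: L2_norm_on_sq)
  qed
  \<comment> \<open>Nodal interpolation does not increase the energy, elementwise by the first part
    of \<open>interp_coarse\<close>; the second part gives \<open>err\<close>.\<close>
  have Wle: "L2_norm_on {0..1} (deriv W) \<le> 1"
    and err: "\<And>k. k \<in> {p<..q} \<Longrightarrow> L2_norm_on (elem x k) (\<lambda>t. V t - W t) \<le>
      len x k / pi * L2_norm_on (elem x k) (deriv V)"
  proof -
    have co: "(slope x c k)\<^sup>2 * len x k \<le> (L2_norm_on (elem x k) (deriv V))\<^sup>2"
      "L2_norm_on (elem x k) (\<lambda>t. V t - (V (x (k - 1)) + slope x c k * (t - x (k - 1)))) \<le>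
        len x k / pi * L2_norm_on (elem x k) (deriv V)" if k: "k \<in> {p<..q}" for k
      using lat.interp_coarse[of 0 "x (k - 1)" "x k" "2 * int N" v] in01[OF k] node_less[of k]
      by (simp_all add: lattice_0 lattice_2N V_def lat_fun_def c_def slope_def len_def elem_def)
    have "(L2_norm_on {0..1} (deriv W))\<^sup>2 = (\<Sum>k\<in>{p<..q}. (slope x c k)\<^sup>2 * len x k)"
      using integral_unique[OF energy[OF less_imp_le[OF pq], of c]] by (simp add: L2_norm_on_sq W_def cell)
    also have "\<dots> \<le> (\<Sum>k\<in>{p<..q}. (L2_norm_on (elem x k) (deriv V))\<^sup>2)" by (intro sum_mono co(1))
    also have "\<dots> = 1\<^sup>2" using Vsum by simp
    finally show "L2_norm_on {0..1} (deriv W) \<le> 1" by (rule power2_le_imp_le) simp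
    show "L2_norm_on (elem x k) (\<lambda>t. V t - W t) \<le> len x k / pi * L2_norm_on (elem x k) (deriv V)"
      if k: "k \<in> {p<..q}" for k
    proof -
      have "L2_norm_on (elem x k) (\<lambda>t. V t - W t) =
          L2_norm_on (elem x k) (\<lambda>t. V t - (V (x (k - 1)) + slope x c k * (t - x (k - 1))))"
        by (rule L2_norm_on_cong[of "{}"]) (simp_all add: W_def interp_eq c_def)
      then show ?thesis using co(2)[OF k] by simp
    qed
  qed

  \<comment> \<open>Such an element is a single lattice interval, so both interpolations use the
    same two nodal values there.\<close>
  have agree: "V t = W t \<and> IE t = IH t" if k: "\<not> elem x k \<subseteq> \<Omega>\<^sub>c" and t: "t \<in> elem x k" for k t
  proof -
    obtain l where l: "x (k - 1) = lattice N (l - 1)" "x k = lattice N l"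
      using elem_not_ext[OF k] by blast
    have t': "t \<in> elem (lattice N) l" using t by (simp add: elem_def l)
    have c: "c k = v l" "c (k - 1) = v (l - 1)" by (simp_all add: c_def l Vl)
    show ?thesis
      unfolding W_def IE_def IH_def V_def lat_fun_def interp_eq[OF t] lat.interp_eq[OF t']
      by (simp add: c l slope_def len_def)
  qed
  have off: "V t = W t \<and> IE t = IH t" if "t \<notin> \<Omega>\<^sub>c" for t
    using agree that elem_exists by blast

  define F1 F2 where "F1 k = L2_norm_on (elem x k) (deriv f)"
    and "F2 k = L2_norm_on (elem x k) (deriv (deriv f))" for k
  define h where "h = len x"
  \<comment> \<open>\<open>A\<close> collects the terms with the second derivative of
    \<open>f\<close> and \<open>B\<close> those with the first; the index 1 refers to the lattice
    and 2 to the mesh.\<close>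
  define B2 A2 where "B2 = (\<Sum>k\<in>G. h k ^ 4 * (F1 k)\<^sup>2)" and "A2 = (\<Sum>k\<in>G. h k ^ 4 * (F2 k)\<^sup>2)"
  define B1 A1 where "B1 = (\<Sum>k\<in>G. eps N ^ 4 * (F1 k)\<^sup>2)" and "A1 = (\<Sum>k\<in>G. eps N ^ 4 * (F2 k)\<^sup>2)"
  note defs = A1_def A2_def B1_def B2_def h_def F1_def F2_def

  \<comment> \<open>Norms summed over lattice elements become norms summed over mesh elements, so
    the lattice quadrature error can be charged to the elementwise \<open>eta_q_sq\<close>.\<close>
  have glue: "(\<Sum>l\<in>G'. (L2_norm_on (elem (lattice N) l) g)\<^sup>2) = (\<Sum>k\<in>G. (L2_norm_on (elem x k) g)\<^sup>2)"
    if g: "\<And>a b. a < b \<Longrightarrow> C2_on f {a..b} \<Longrightarrow> (\<lambda>t. (g t)\<^sup>2) integrable_on {a..b}" for g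
  proof (rule has_integral_unique)
    show "((\<lambda>t. if t \<in> \<Omega>\<^sub>c then (g t)\<^sup>2 else 0) has_integral
        (\<Sum>k\<in>G. (L2_norm_on (elem x k) g)\<^sup>2)) {0..1}"
      unfolding G_def cell(1)[symmetric]
      using g[OF node_less] C2_elem elem_disjoint pq
      by (intro L2_split) (auto simp: elem_def)
    show "((\<lambda>t. if t \<in> \<Omega>\<^sub>c then (g t)\<^sup>2 else 0) has_integral
        (\<Sum>l\<in>G'. (L2_norm_on (elem (lattice N) l) g)\<^sup>2)) {0..1}"
      unfolding G'_def cell(2)[symmetric]
      using g[OF lat.node_less] C2_lattice_elem lattice_elem_disjoint
      by (intro lat.L2_split) (auto simp: elem_def)
  qed

  obtain E1 where E1: "((\<lambda>t. if t \<in> \<Omega>\<^sub>c then f t * V t - IE t else 0) has_integral E1) {0..1}"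
    and E1': "\<bar>E1\<bar> \<le> sqrt A1 / (8 * pi) + sqrt B1 / 4"
  proof -
    have D: "elem (lattice N) l \<subseteq> \<Omega>\<^sub>c \<and> C2_on f (elem (lattice N) l) \<or>
        {lattice N (l - 1)<..<lattice N l} \<inter> \<Omega>\<^sub>c = {}" for l
      using C2_lattice_elem lattice_elem_disjoint by blast
    have "eps N ^ 4 * (\<Sum>l\<in>G'. (L2_norm_on (elem (lattice N) l) (deriv f))\<^sup>2) = B1"
      "eps N ^ 4 * (\<Sum>l\<in>G'. (L2_norm_on (elem (lattice N) l) (deriv (deriv f)))\<^sup>2) = A1"
      by (simp_all add: glue C2_on_deriv_sq_integrable defs sum_distrib_left)
    then have s: "(\<Sum>l\<in>G'. eps N ^ 4 * (L2_norm_on (elem (lattice N) l) (deriv f))\<^sup>2) = B1"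
      "(\<Sum>l\<in>G'. eps N ^ 4 * (L2_norm_on (elem (lattice N) l) (deriv (deriv f)))\<^sup>2) = A1"
      by (simp_all add: sum_distrib_left)
    have N0: "0 < 2 * int N" using N by simp
    have l1: "lattice N (2 * int N) = lattice N 0 + 1" by (simp add: lattice_0 lattice_2N)
    have V': "V = pw_affine (lattice N) v" by (simp add: V_def lat_fun_def)
    show thesis
      using lat.quadrature_error[OF N0 l1 v0 contf D] that
      unfolding V'[symmetric] IE_def[symmetric] G'_def[symmetric] cell len_lattice s Vnorm mult_1_right
      by blast
  qed
  obtain E2 where E2: "((\<lambda>t. if t \<in> \<Omega>\<^sub>c then f t * W t - IH t else 0) has_integral E2) {0..1}"
    and E2': "\<bar>E2\<bar> \<le> sqrt A2 / (8 * pi) + sqrt B2 / 4"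
  proof -
    have D: "elem x k \<subseteq> \<Omega>\<^sub>c \<and> C2_on f (elem x k) \<or> {x (k - 1)<..<x k} \<inter> \<Omega>\<^sub>c = {}" for k
      using C2_elem elem_disjoint by blast
    have x1: "x q = x p + 1" by (simp add: p xq)
    obtain E where E: "((\<lambda>t. if t \<in> \<Omega>\<^sub>c then f t * W t - IH t else 0) has_integral E) {0..1}"
      "\<bar>E\<bar> \<le> (sqrt A2 / (8 * pi) + sqrt B2 / 4) * L2_norm_on {0..1} (deriv W)"
      using quadrature_error[OF pq x1 c0 contf D]
      unfolding W_def[symmetric] IH_def[symmetric] G_def[symmetric] cell defs[symmetric] by blast
    have "0 \<le> A2" "0 \<le> B2" by (auto simp: A2_def B2_def intro!: sum_nonneg)
    then have "(sqrt A2 / (8 * pi) + sqrt B2 / 4) * L2_norm_on {0..1} (deriv W) \<le>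
        (sqrt A2 / (8 * pi) + sqrt B2 / 4) * 1"
      by (intro mult_left_mono Wle) auto
    then show thesis using that E by simp
  qed

  define B where "B k = integral (elem x k) (\<lambda>t. f t * (V t - W t))" for k
  have contfS: "continuous_on S f" for S using contf by (rule continuous_on_subset) simp
  have Bint: "((\<lambda>t. f t * (V t - W t)) has_integral (\<Sum>k\<in>{p<..q}. B k)) {0..1}"
    unfolding cell(1)[symmetric] B_def elem_def
    by (intro has_integral_elems[OF less_imp_le[OF pq], unfolded elem_def] integrable_integral
      integrable_continuous_interval continuous_intros contfS cont)
  have etaf: "(\<Sum>k\<in>{p<..q}. B k) \<le> eta_f N La Ra K x f"
  proof -
    have GP: "G \<subseteq> {p<..q}" unfolding G_def by blast
    \<comment> \<open>Outside \<open>G\<close> the two interpolants coincide, so only elements that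
      enter \<open>eta_f\<close> contribute.\<close>
    have "B k = 0" if "k \<in> {p<..q} - G" for k
    proof -
      have "B k = integral (elem x k) (\<lambda>_. 0)"
        unfolding B_def by (rule integral_cong) (use agree that in \<open>auto simp: G_def\<close>)
      then show ?thesis by simp
    qed
    then have "(\<Sum>k\<in>{p<..q}. B k) = (\<Sum>k\<in>G. B k)"
      using GP by (intro sum.mono_neutral_right) auto
    also have "\<dots> \<le> (\<Sum>k\<in>G. (len x k / pi * L2_norm_on (elem x k) f) * L2_norm_on (elem x k) (deriv V))"
    proof (rule sum_mono)
      fix k assume "k \<in> G"
      then have k: "k \<in> {p<..q}" using GP by blast
      have "B k \<le> L2_norm_on (elem x k) f * L2_norm_on (elem x k) (\<lambda>t. V t - W t)"
        unfolding B_def elem_def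
        by (rule order_trans[OF abs_ge_self]) (intro abs_integral_mult_le integrable_continuous_interval
          continuous_intros contfS cont)
      also have "\<dots> \<le> L2_norm_on (elem x k) f * (len x k / pi * L2_norm_on (elem x k) (deriv V))"
        by (intro mult_left_mono err k L2_norm_on_nonneg)
      finally show "B k \<le> (len x k / pi * L2_norm_on (elem x k) f) * L2_norm_on (elem x k) (deriv V)"
        by (simp add: mult_ac)
    qed
    also have "\<dots> \<le> sqrt (\<Sum>k\<in>G. (len x k / pi * L2_norm_on (elem x k) f)\<^sup>2) *
        sqrt (\<Sum>k\<in>G. (L2_norm_on (elem x k) (deriv V))\<^sup>2)"
      by (rule sum_mult_le_sqrt)
    also have "\<dots> \<le> sqrt (\<Sum>k\<in>G. (len x k / pi * L2_norm_on (elem x k) f)\<^sup>2) * 1"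
    proof (intro mult_left_mono)
      have "(\<Sum>k\<in>G. (L2_norm_on (elem x k) (deriv V))\<^sup>2) \<le> 1"
        unfolding Vsum[symmetric] using GP by (intro sum_mono2) auto
      then show "sqrt (\<Sum>k\<in>G. (L2_norm_on (elem x k) (deriv V))\<^sup>2) \<le> 1" by simp
    qed (auto intro: sum_nonneg)
    also have "\<dots> = eta_f N La Ra K x f"
      unfolding eta_f_def sum_elems_ext[of "eta_f_sq x f" p, OF eta_periodic(1)] G_def q_def
      by (simp add: eta_f_sq_def power_mult_distrib power_divide)
    finally show ?thesis .
  qed

  have etaq: "eta_q N La Ra K x f = sqrt (B1 + B2 + (A1 + A2) / (4 * pi\<^sup>2))"
  proof -
    have "(\<Sum>k\<in>G. eta_q_sq N x f k) = B1 + B2 + (A1 + A2) / (4 * pi\<^sup>2)"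
      by (simp add: eta_q_sq_def defs sum.distrib[symmetric] sum_divide_distrib distrib_right add_divide_distrib)
    then show ?thesis
      unfolding eta_q_def sum_elems_ext[of "eta_q_sq N x f" p, OF eta_periodic(2)] G_def q_def by simp
  qed
  have nn: "0 \<le> A1" "0 \<le> A2" "0 \<le> B1" "0 \<le> B2"
    by (auto simp: A1_def A2_def B1_def B2_def intro!: sum_nonneg)
  \<comment> \<open>The quadrature bounds consist of four terms, each one quarter of a square root
    that is at most \<open>eta_q\<close>; together they give \<open>eta_q\<close> once.\<close>
  have quarter: "sqrt y \<le> eta_q N La Ra K x f" if "y \<le> B1 + B2 + (A1 + A2) / (4 * pi\<^sup>2)" for y
    using that unfolding etaq by simp
  \<comment> \<open>The factor \<open>1 / (8 * pi)\<close> splits into the common quarter and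
    \<open>1 / (2 * pi)\<close>, the weight of the second derivative in
    \<open>eta_q\<close>.\<close>
  have a: "sqrt A / (8 * pi) = sqrt (A / (4 * pi\<^sup>2)) / 4" for A
    by (simp add: real_sqrt_divide real_sqrt_mult)
  have nn': "0 \<le> A1 / (4 * pi\<^sup>2)" "0 \<le> A2 / (4 * pi\<^sup>2)" using nn by simp_all
  have bounds: "sqrt (A1 / (4 * pi\<^sup>2)) \<le> eta_q N La Ra K x f" "sqrt (A2 / (4 * pi\<^sup>2)) \<le> eta_q N La Ra K x f"
    "sqrt B1 \<le> eta_q N La Ra K x f" "sqrt B2 \<le> eta_q N La Ra K x f"
    using nn nn' by (intro quarter; simp add: add_divide_distrib)+

  \<comment> \<open>Inside the region the terms \<open>f * V\<close> and \<open>f * W\<close>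
    cancel; outside it \<open>V = W\<close> and \<open>IE = IH\<close>, so both sides
    vanish.\<close>
  have "R_ext N x f v = - E1 + E2 + (\<Sum>k\<in>{p<..q}. B k)"
  proof -
    have "((\<lambda>t. - (if t \<in> \<Omega>\<^sub>c then f t * V t - IE t else 0) + (if t \<in> \<Omega>\<^sub>c then f t * W t - IH t else 0)
        + f t * (V t - W t)) has_integral (- E1 + E2 + (\<Sum>k\<in>{p<..q}. B k))) {0..1}"
      by (intro has_integral_add has_integral_neg E1 E2 Bint)
    then have "((\<lambda>t. IE t - IH t) has_integral (- E1 + E2 + (\<Sum>k\<in>{p<..q}. B k))) {0..1}"
      by (rule has_integral_eq[rotated]) (use off in \<open>auto simp: algebra_simps\<close>)
    moreover have "((\<lambda>t. IE t - IH t) has_integral (integral {0..1} IE - integral {0..1} IH)) {0..1}"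
      by (intro has_integral_diff integrable_integral integrable_continuous_interval cont)
    ultimately show ?thesis unfolding R by (metis has_integral_unique)
  qed
  then show ?thesis using E1' E2' etaf bounds unfolding a by linarith
qed

end

theorem proposition2:
  fixes N K :: nat and La Ra :: real and x :: "int \<Rightarrow> real" and f :: "real \<Rightarrow> real"
  assumes "N \<ge> 1"
    and "-1/2 < La" and "La < Ra" and "Ra < 1/2"
    and "qc_mesh N La Ra K x"
    and "continuous_on UNIV f" and "\<And>t. f (t + 1) = f t"
    and "C2_ext N La Ra x f"
  shows "dual_norm_U N (R_ext N x f) \<le> eta_f N La Ra K x f + eta_q N La Ra K x f"
proof -
  interpret force N K La Ra x f
    using assms by unfold_locales
  show ?thesis
    unfolding dual_norm_U_def
    by (rule cSup_least) (use unit_sphere_nonempty R_ext_le in auto)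
qed

end
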